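(* Let $\mathbb D\subset\mathbb C$ be a simply connected neighbourhood of $0$, and let $\xi(z)=\sum_{i=-1}^\infty\xi_i(z)\lambda^i\,dz$ be a holomorphic potential on $\mathbb D$ with $$\xi_{-1}=\begin{pmatrix} 0 & a(z) \\ b(z) & 0 \end{pmatrix},\qquad a(0)\neq0,\qquad B(z):=-b(z)a(z).$$ Let $C$ be the solution of $dC=C\xi$ with initial condition $$C(0,\lambda)=\frac1{\sqrt2}\begin{pmatrix} e^{ic} & i e^{ic}\lambda \\ i e^{-ic}\lambda^{-1} & e^{-ic} \end{pmatrix},\qquad c\in\mathbb R .$$ Then the resulting generalized spacelike maximal surface $f$ in $\mathrm{Nil}^3_1$ obtained through the DPW method has a singular point at $z=0$, and the quadratic differential $B\,dz^2$ is the Abresch-Rosenberg differential of $f$.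
   Context: $\mathrm{Nil}^3_1$ is the Heisenberg group $\mathbb R^3$ with product $(x_1,x_2,x_3)\cdot(\tilde x_1,\tilde x_2,\tilde x_3)=(x_1+\tilde x_1,\,x_2+\tilde x_2,\,x_3+\tilde x_3+\frac12(x_1\tilde x_2-\tilde x_1x_2))$, with left-invariant vector fields $e_1=\partial_{x_1}-\frac{x_2}{2}\partial_{x_3}$, $e_2=\partial_{x_2}+\frac{x_1}{2}\partial_{x_3}$, $e_3=\partial_{x_3}$, and the left-invariant Lorentzian metric for which $e_1,e_2,e_3$ are orthogonal with $\langle e_1,e_1\rangle=\langle e_2,e_2\rangle=1$, $\langle e_3,e_3\rangle=-1$. In a holomorphic potential, the $\xi_i$ are holomorphic $\mathfrak{sl}(2,\mathbb C)$-valued functions, diagonal for even $i$ and off-diagonal for odd $i$. $\Lambda SU(2)_\sigma$ is the group of loops $F(\lambda)$, $\lambda\in\mathbb S^1$, in $SU(2)$ with diagonal entries even and off-diagonal entries odd in $\lambda$; $\Lambda SL(2,\mathbb C)_\sigma$ is defined in the same way with values in $SL(2,\mathbb C)$; $\Lambda^+SL(2,\mathbb C)_\sigma$ is the subgroup of loops extending holomorphically in $\lambda$ to the unit disc. DPW method: shrink $\mathbb D$ so that $a\neq0$ on $\mathbb D$; take the pointwise Iwasawa decomposition $C=FB_+$, $F\in\Lambda SU(2)_\sigma$, $B_+\in\Lambda^+SL(2,\mathbb C)_\sigma$; then $g=-F_{11}/F_{21}|_{\lambda=1}$, which is the stereographic projection from the north pole of $N=\mathrm{Ad}_FE_3|_{\lambda=1}$,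 $E_3=\frac12\mathrm{diag}(i,-i)$, is a nowhere holomorphic harmonic map into $\mathbb C\cup\{\infty\}$ (i.e. $g_{\bar z}\ne0$ everywhere, with $1/g$ used where $g=\infty$). The resulting generalized spacelike maximal surface is the map $f:\mathbb D\to\mathrm{Nil}^3_1$, unique up to left translation, whose left-translated derivative is $f^{-1}f_z=-i\omega(1-g^2)e_1+\omega(1+g^2)e_2+2g\omega e_3$ with $\omega=-2i\,\partial_z(\bar g)/(|g|^2+1)^2$. A singular point is a point where $f$ is not an immersion. The Abresch-Rosenberg differential of $f$ is $\frac{g_z\,\partial_z(\bar g)}{(1+|g|^2)^2}\,dz^2$. *)

theory Defs
  imports "HOL-Complex_Analysis.Complex_Analysis"
begin

section \<open>Loop groups\<close>

definition SU2 :: "(complex^2^2) set" where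
  "SU2 = {A. A ** (\<chi> j k. cnj (A $ k $ j)) = mat 1 \<and> det A = 1}"

text \<open>A loop is a function on the complex plane of which only the values on the unit circle
  matter. No regularity beyond continuity is imposed.\<close>

definition twisted :: "(complex \<Rightarrow> complex^2^2) \<Rightarrow> bool" where
  "twisted \<gamma> \<longleftrightarrow> (\<forall>l\<in>sphere 0 1. \<forall>j k.
     \<gamma> (- l) $ j $ k = (if j = k then \<gamma> l $ j $ k else - (\<gamma> l $ j $ k)))"

definition Loop_SL2 :: "(complex \<Rightarrow> complex^2^2) set" where
  "Loop_SL2 = {\<gamma>. continuous_on (sphere 0 1) \<gamma> \<and> (\<forall>l\<in>sphere 0 1. det (\<gamma> l) = 1) \<and> twisted \<gamma>}"

definition Loop_SU2 :: "(complex \<Rightarrow> complex^2^2) set" where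
  "Loop_SU2 = {\<gamma>. continuous_on (sphere 0 1) \<gamma> \<and> (\<forall>l\<in>sphere 0 1. \<gamma> l \<in> SU2) \<and> twisted \<gamma>}"

definition Loop_SL2_plus :: "(complex \<Rightarrow> complex^2^2) set" where
  "Loop_SL2_plus = {\<gamma> \<in> Loop_SL2. \<exists>H. continuous_on (cball 0 1) H \<and>
     (\<forall>j k. (\<lambda>l. H l $ j $ k) holomorphic_on ball 0 1) \<and> (\<forall>l\<in>sphere 0 1. H l = \<gamma> l)}"

section \<open>Holomorphic potentials and the DPW method\<close>

definition potential_partial ::
    "(int \<Rightarrow> complex \<Rightarrow> complex^2^2) \<Rightarrow> nat \<Rightarrow> complex \<Rightarrow> complex \<Rightarrow> complex^2^2" where
  "potential_partial \<xi> n z l = (\<chi> j k. \<Sum>i\<in>{-1..int n}. \<xi> i z $ j $ k * l powi i)"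

definition potential :: "(int \<Rightarrow> complex \<Rightarrow> complex^2^2) \<Rightarrow> complex \<Rightarrow> complex \<Rightarrow> complex^2^2" where
  "potential \<xi> z l = lim (\<lambda>n. potential_partial \<xi> n z l)"

text \<open>Only the coefficients with index at least \<open>-1\<close> matter. The last condition makes precise
  that the series defines a family of loops: it converges locally uniformly in \<open>z\<close>, uniformly
  for \<open>l\<close> on the unit circle.\<close>

definition holomorphic_potential :: "complex set \<Rightarrow> (int \<Rightarrow> complex \<Rightarrow> complex^2^2) \<Rightarrow> bool" where
  "holomorphic_potential D \<xi> \<longleftrightarrow>
     (\<forall>i\<ge>-1. (\<forall>j k. (\<lambda>z. \<xi> i z $ j $ k) holomorphic_on D) \<and>
        (\<forall>z\<in>D. trace (\<xi> i z) = 0 \<and>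
           (even i \<longrightarrow> (\<forall>j k. j \<noteq> k \<longrightarrow> \<xi> i z $ j $ k = 0)) \<and>
           (odd i \<longrightarrow> (\<forall>j. \<xi> i z $ j $ j = 0)))) \<and>
     (\<forall>K. compact K \<and> K \<subseteq> D \<longrightarrow>
        uniformly_convergent_on (K \<times> sphere 0 1) (\<lambda>n (z, l). potential_partial \<xi> n z l))"

text \<open>\<open>dC = C \<xi>\<close> as an equation of holomorphic 1-forms in \<open>z\<close>, for each \<open>l\<close> on the circle.\<close>

definition solves_potential ::
    "complex set \<Rightarrow> (int \<Rightarrow> complex \<Rightarrow> complex^2^2) \<Rightarrow> (complex \<Rightarrow> complex \<Rightarrow> complex^2^2) \<Rightarrow> bool" where
  "solves_potential D \<xi> C \<longleftrightarrow> (\<forall>l\<in>sphere 0 1. \<forall>z\<in>D. \<forall>j k.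
     ((\<lambda>w. C w l $ j $ k) has_field_derivative (C z l ** potential \<xi> z l) $ j $ k) (at z))"

text \<open>The decomposition is pointwise in \<open>z\<close>: nothing is required about the dependence of the two
  factors on \<open>z\<close>.\<close>

definition iwasawa_decomposition ::
    "complex set \<Rightarrow> (complex \<Rightarrow> complex \<Rightarrow> complex^2^2) \<Rightarrow> (complex \<Rightarrow> complex \<Rightarrow> complex^2^2) \<Rightarrow>
     (complex \<Rightarrow> complex \<Rightarrow> complex^2^2) \<Rightarrow> bool" where
  "iwasawa_decomposition D C F Bp \<longleftrightarrow> (\<forall>z\<in>D. F z \<in> Loop_SU2 \<and> Bp z \<in> Loop_SL2_plus \<and>
     (\<forall>l\<in>sphere 0 1. C z l = F z l ** Bp z l))"

section \<open>Maps into the Riemann sphere\<close>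

text \<open>The Riemann sphere is \<open>complex option\<close>, with \<open>None\<close> in the role of infinity. The value
  \<open>affine None = 0\<close> is a dummy.\<close>

definition affine :: "complex option \<Rightarrow> complex" where
  "affine p = (case p of None \<Rightarrow> 0 | Some w \<Rightarrow> w)"

definition sphere_inv :: "complex option \<Rightarrow> complex option" where
  "sphere_inv p = (case p of None \<Rightarrow> Some 0 | Some w \<Rightarrow> if w = 0 then None else Some (1 / w))"

text \<open>\<open>local_rep g z\<close> is \<open>g\<close> if \<open>g z\<close> is finite and \<open>1/g\<close> if \<open>g z\<close> is infinite; it is only
  meaningful close to \<open>z\<close>.\<close>

definition local_rep :: "(complex \<Rightarrow> complex option) \<Rightarrow> complex \<Rightarrow> complex \<Rightarrow> complex" where
  "local_rep g z = (if g z \<noteq> None then (\<lambda>w. affine (g w)) else (\<lambda>w. affine (sphere_inv (g w))))"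

definition sphere_differentiable_at :: "(complex \<Rightarrow> complex option) \<Rightarrow> complex \<Rightarrow> bool" where
  "sphere_differentiable_at g z \<longleftrightarrow>
     (\<forall>\<^sub>F w in nhds z. if g z \<noteq> None then g w \<noteq> None else sphere_inv (g w) \<noteq> None) \<and>
     local_rep g z differentiable (at z)"

definition gauss_map :: "(complex \<Rightarrow> complex \<Rightarrow> complex^2^2) \<Rightarrow> complex \<Rightarrow> complex option" where
  "gauss_map F z = (if F z 1 $ 2 $ 1 = 0 then None else Some (- (F z 1 $ 1 $ 1) / (F z 1 $ 2 $ 1)))"

text \<open>The Wirtinger derivative \<open>\<partial>/\<partial>z = (\<partial>/\<partial>x - i \<partial>/\<partial>y) / 2\<close> of a real differentiable map.\<close>

definition wirtinger :: "(complex \<Rightarrow> complex) \<Rightarrow> complex \<Rightarrow> complex" where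
  "wirtinger h z = (frechet_derivative h (at z) 1 - \<i> * frechet_derivative h (at z) \<i>) / 2"

section \<open>The Heisenberg group and the surface\<close>

definition nil_mult :: "real^3 \<Rightarrow> real^3 \<Rightarrow> real^3" where
  "nil_mult x y = vector [x $ 1 + y $ 1, x $ 2 + y $ 2,
     x $ 3 + y $ 3 + (x $ 1 * y $ 2 - y $ 1 * x $ 2) / 2]"

definition e1 :: "real^3 \<Rightarrow> real^3" where "e1 x = vector [1, 0, - (x $ 2) / 2]"
definition e2 :: "real^3 \<Rightarrow> real^3" where "e2 x = vector [0, 1, x $ 1 / 2]"
definition e3 :: "real^3 \<Rightarrow> real^3" where "e3 x = vector [0, 0, 1]"

text \<open>The fields are the left translates of the coordinate vectors at the identity.\<close>

lemma left_translates:
  "((\<lambda>t. nil_mult x (t *\<^sub>R axis 1 1)) has_vector_derivative e1 x) (at 0)"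
  "((\<lambda>t. nil_mult x (t *\<^sub>R axis 2 1)) has_vector_derivative e2 x) (at 0)"
  "((\<lambda>t. nil_mult x (t *\<^sub>R axis 3 1)) has_vector_derivative e3 x) (at 0)"
proof -
  have "nil_mult x (t *\<^sub>R axis 1 1) = x + t *\<^sub>R e1 x"
       "nil_mult x (t *\<^sub>R axis 2 1) = x + t *\<^sub>R e2 x"
       "nil_mult x (t *\<^sub>R axis 3 1) = x + t *\<^sub>R e3 x" for t
    by (simp_all add: vec_eq_iff forall_3 nil_mult_def e1_def e2_def e3_def axis_def)
  then show
    "((\<lambda>t. nil_mult x (t *\<^sub>R axis 1 1)) has_vector_derivative e1 x) (at 0)"
    "((\<lambda>t. nil_mult x (t *\<^sub>R axis 2 1)) has_vector_derivative e2 x) (at 0)"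
    "((\<lambda>t. nil_mult x (t *\<^sub>R axis 3 1)) has_vector_derivative e3 x) (at 0)"
    by (auto intro!: derivative_eq_intros simp: has_vector_derivative_def)
qed

text \<open>The coefficients of \<open>f\<^sup>-\<^sup>1 f\<^sub>z\<close> in the left-invariant frame. Where \<open>g\<close> is infinite, the triple
  is the one obtained by substituting \<open>g = 1/h\<close> in the formula for finite \<open>g\<close>: then
  \<open>\<eta> = g\<^sup>2 \<omega>\<close>, \<open>h \<eta> = g \<omega>\<close> and \<open>h\<^sup>2 \<eta> = \<omega>\<close>.\<close>

definition surface_form :: "(complex \<Rightarrow> complex option) \<Rightarrow> complex \<Rightarrow> complex^3" where
  "surface_form g z =
     (if g z \<noteq> None then
        let h = local_rep g z;
            \<omega> = - 2 * \<i> * wirtinger (\<lambda>w. cnj (h w)) z / ((cmod (h z))\<^sup>2 + 1)\<^sup>2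
        in vector [- \<i> * \<omega> * (1 - (h z)\<^sup>2), \<omega> * (1 + (h z)\<^sup>2), 2 * h z * \<omega>]
      else
        let h = local_rep g z;
            \<eta> = 2 * \<i> * wirtinger (\<lambda>w. cnj (h w)) z / ((cmod (h z))\<^sup>2 + 1)\<^sup>2
        in vector [- \<i> * \<eta> * ((h z)\<^sup>2 - 1), \<eta> * ((h z)\<^sup>2 + 1), 2 * h z * \<eta>])"

text \<open>\<open>f\<^sup>-\<^sup>1 f\<^sub>z = \<phi>\<^sub>1 e\<^sub>1 + \<phi>\<^sub>2 e\<^sub>2 + \<phi>\<^sub>3 e\<^sub>3\<close>, written in the complexified tangent space at \<open>f z\<close>.\<close>

definition maximal_surface_of :: "complex set \<Rightarrow> (complex \<Rightarrow> complex option) \<Rightarrow> (complex \<Rightarrow> real^3) \<Rightarrow> bool" where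
  "maximal_surface_of D g f \<longleftrightarrow> (\<forall>z\<in>D. f differentiable (at z) \<and>
     (\<forall>k. wirtinger (\<lambda>w. complex_of_real (f w $ k)) z =
        surface_form g z $ 1 * complex_of_real (e1 (f z) $ k) +
        surface_form g z $ 2 * complex_of_real (e2 (f z) $ k) +
        surface_form g z $ 3 * complex_of_real (e3 (f z) $ k)))"

definition immersion_at :: "(complex \<Rightarrow> real^3) \<Rightarrow> complex \<Rightarrow> bool" where
  "immersion_at f z \<longleftrightarrow> (\<exists>f'. (f has_derivative f') (at z) \<and> inj f')"

definition singular_point :: "(complex \<Rightarrow> real^3) \<Rightarrow> complex \<Rightarrow> bool" where
  "singular_point f z \<longleftrightarrow> \<not> immersion_at f z"

text \<open>The coefficient of \<open>dz\<^sup>2\<close>. The expression \<open>g\<^sub>z (cnj g)\<^sub>z / (1 + |g|\<^sup>2)\<^sup>2\<close> is unchanged when \<open>g\<close>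
  is replaced by \<open>1/g\<close>, so it can be evaluated with either.\<close>

definition abresch_rosenberg :: "(complex \<Rightarrow> complex option) \<Rightarrow> complex \<Rightarrow> complex" where
  "abresch_rosenberg g z = (let h = local_rep g z in
     wirtinger h z * wirtinger (\<lambda>w. cnj (h w)) z / (1 + (cmod (h z))\<^sup>2)\<^sup>2)"

definition is_abresch_rosenberg ::
    "complex set \<Rightarrow> (complex \<Rightarrow> complex option) \<Rightarrow> (complex \<Rightarrow> complex) \<Rightarrow> bool" where
  "is_abresch_rosenberg D g Q \<longleftrightarrow>
     (\<forall>z\<in>D. sphere_differentiable_at g z \<and> Q z = abresch_rosenberg g z)"

end

theory Submission
  imports Defs
begin

text \<open>The Gauss map only sees the first column of the unitary frame \<open>F\<close> at \<open>l = 1\<close>, so what has to be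
  understood is how \<open>F z 1\<close> varies to first order with \<open>z\<close>. Fix \<open>z\<close> and write \<open>F (z + h) = F z G\<close>. On the
  circle \<open>G\<close> takes values in \<open>SU(2)\<close>, and the two Iwasawa decompositions give \<open>G = H P W\<close>, where \<open>H\<close> and
  \<open>W\<close> (from \<open>Bp z\<close> and the inverse of \<open>Bp (z + h)\<close>) extend holomorphically to the disc and \<open>P\<close> is the
  transition matrix with \<open>C (z + h) = C z P\<close>. The decomposition is only pointwise in \<open>z\<close>, so the
  expansion of \<open>G\<close> in \<open>h\<close> has to be extracted from this identity.

  By the differential equation, \<open>P = 1 + h \<xi> z + O(h\<^sup>2)\<close>. Cutting a loop into its positive and negative
  Fourier parts is not a bounded operation for the supremum norm on the circle, so an \<open>O(h\<^sup>2)\<close> error on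
  the circle alone would be useless. However, \<open>P\<close> is a power series in \<open>h / l\<close> with coefficients in the
  disc algebra, hence extends to an annulus inside the unit circle, and the error bound holds there
  (\<open>transition_matrix\<close>). So \<open>G\<close> extends to the annulus as well, and since \<open>G 2 2 = cnj (G 1 1)\<close> and
  \<open>G 1 2 = - cnj (G 2 1)\<close> on the circle, \<open>G\<close> is determined on the circle, up to the constant term, by its
  negative Laurent parts (\<open>reality_formula\<close>). Those are Cauchy integrals over \<open>|s| = 1/2\<close>, where errors
  are harmless. The loops \<open>H\<close> and \<open>W\<close> contribute only through their diagonal values at \<open>0\<close>, and with
  \<open>H 0 = diag(r, 1/r)\<close> the outcome is
  \<open>G 2 1 / G 1 1 = \<beta> h - cnj (\<alpha> h) + O(h\<^sup>2)\<close> at \<open>l = 1\<close>, with \<open>\<alpha> = a r\<^sup>2\<close> and \<open>\<beta> = b / r\<^sup>2\<close>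
  (\<open>frame_motion\<close>).

  The Gauss map is the image of this quotient under a rotation of the Riemann sphere, so it is
  differentiable, and \<open>g\<^sub>z (cnj g)\<^sub>z / (1 + |g|\<^sup>2)\<^sup>2\<close>, being invariant under rotations, equals \<open>\<beta> (- \<alpha>) = - a b\<close>:
  the unknown \<open>r\<close> cancels (\<open>gauss_map_hopf\<close>).

  At \<open>z = 0\<close> the initial value \<open>C 0\<close> is itself unitary, so \<open>Bp 0\<close> is unitary as well as positive, hence
  constant and diagonal. It therefore rescales the first column of \<open>C 0\<close>, whose entries have equal
  modulus, so \<open>|g| = 1\<close> (\<open>gauss_map_unimodular\<close>). For \<open>|g| = 1\<close> the three coefficients of \<open>f\<^sup>-\<^sup>1 f\<^sub>z\<close> are
  a common complex multiple of a real vector, so \<open>df\<close> has rank at most one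
  (\<open>singular_point_if_unimodular\<close>).\<close>

(* Throughout, $ selects matrix entries and never power series coefficients. *)
no_notation fps_nth (infixl "$" 75)

section \<open>The disc algebra\<close>

text \<open>The boundary values of these functions are the entries of the positive loops, the loops that extend
  holomorphically to the disc.\<close>

definition disc_algebra :: "(complex \<Rightarrow> complex) \<Rightarrow> bool" where
  "disc_algebra u \<longleftrightarrow> continuous_on (cball 0 1) u \<and> u holomorphic_on ball 0 1"

lemma disc_algebra_const: "disc_algebra (\<lambda>_. c)"
  and disc_algebra_id: "disc_algebra (\<lambda>l. l)"
  by (auto simp: disc_algebra_def)

lemma disc_algebra_add: "disc_algebra u \<Longrightarrow> disc_algebra v \<Longrightarrow> disc_algebra (\<lambda>l. u l + v l)"
  and disc_algebra_diff: "disc_algebra u \<Longrightarrow> disc_algebra v \<Longrightarrow> disc_algebra (\<lambda>l. u l - v l)"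
  and disc_algebra_mult: "disc_algebra u \<Longrightarrow> disc_algebra v \<Longrightarrow> disc_algebra (\<lambda>l. u l * v l)"
  and disc_algebra_minus: "disc_algebra u \<Longrightarrow> disc_algebra (\<lambda>l. - u l)"
  and disc_algebra_power: "disc_algebra u \<Longrightarrow> disc_algebra (\<lambda>l. u l ^ n)"
  by (auto simp: disc_algebra_def intro!: continuous_intros holomorphic_intros)

lemma disc_algebra_sum: "(\<And>i. i \<in> I \<Longrightarrow> disc_algebra (u i)) \<Longrightarrow> disc_algebra (\<lambda>l. \<Sum>i\<in>I. u i l)"
  by (auto simp: disc_algebra_def intro!: continuous_intros holomorphic_intros)

lemmas disc_algebra_intros = disc_algebra_const disc_algebra_id disc_algebra_add disc_algebra_diff
  disc_algebra_mult disc_algebra_minus disc_algebra_power disc_algebra_sum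

lemma disc_algebra_exp: "disc_algebra u \<Longrightarrow> disc_algebra (\<lambda>l. exp (u l))"
  by (auto simp: disc_algebra_def intro!: continuous_intros holomorphic_intros)

lemma disc_algebra_uniform_limit:
  fixes u :: "nat \<Rightarrow> complex \<Rightarrow> complex"
  assumes "\<And>n. disc_algebra (u n)" and "uniform_limit (cball 0 1) u v sequentially"
  shows "disc_algebra v"
proof (rule holomorphic_uniform_limit[where f=u and g=v and F=sequentially and z=0 and r=1])
  show "\<forall>\<^sub>F n in sequentially. continuous_on (cball 0 1) (u n) \<and> u n holomorphic_on ball 0 1"
    using assms(1) by (auto simp: disc_algebra_def)
qed (use assms(2) in \<open>auto simp: disc_algebra_def\<close>)

lemma disc_algebra_reflect:
  assumes "disc_algebra u" shows "disc_algebra (\<lambda>l. u (- l))"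
proof -
  have "continuous_on (cball 0 1) (\<lambda>l. u (- l))"
    by (rule continuous_on_compose2[of "cball 0 1" u])
       (use assms in \<open>auto simp: disc_algebra_def intro!: continuous_intros\<close>)
  moreover have "u \<circ> uminus holomorphic_on ball 0 1"
    by (rule holomorphic_on_compose_gen[of _ _ _ "ball 0 1"])
       (use assms in \<open>auto simp: disc_algebra_def intro!: holomorphic_intros\<close>)
  ultimately show ?thesis by (simp add: disc_algebra_def o_def)
qed

lemma disc_algebra_bound:
  assumes u: "disc_algebra u" and le: "\<And>l. cmod l = 1 \<Longrightarrow> cmod (u l) \<le> M" and l: "cmod l \<le> 1"
  shows "cmod (u l) \<le> M"
proof (rule maximum_modulus_frontier[of u "cball 0 1"])
  show "u holomorphic_on interior (cball 0 1)" "continuous_on (closure (cball 0 1)) u"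
    using u by (auto simp: disc_algebra_def)
qed (use le l in auto)

lemma disc_algebra_family_bound:
  fixes H :: "2 \<Rightarrow> 2 \<Rightarrow> complex \<Rightarrow> complex"
  assumes "\<And>j k. disc_algebra (H j k)"
  obtains M where "M \<ge> 0" "\<And>j k l. cmod l \<le> 1 \<Longrightarrow> cmod (H j k l) \<le> M"
proof -
  have "\<exists>M. \<forall>l\<in>cball 0 1. cmod (H j k l) \<le> M" for j k
    using assms[of j k] compact_imp_bounded[OF compact_continuous_image[of "cball 0 1" "H j k"]]
    by (auto simp: disc_algebra_def bounded_iff)
  then obtain M where "\<And>j k. \<forall>l\<in>cball 0 1. cmod (H j k l) \<le> M j k" by metis
  then have M: "cmod (H j k l) \<le> M j k" if "cmod l \<le> 1" for j k l using that by simp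
  define N where "N = (\<Sum>j\<in>UNIV. \<Sum>k\<in>UNIV. \<bar>M j k\<bar>)"
  have "M j k \<le> N" for j k
  proof -
    have "M j k \<le> (\<Sum>k\<in>UNIV. \<bar>M j k\<bar>)" using member_le_sum[of k UNIV "\<lambda>k. \<bar>M j k\<bar>"] by simp
    also have "\<dots> \<le> N" unfolding N_def
      using member_le_sum[of j UNIV "\<lambda>j. \<Sum>k\<in>UNIV. \<bar>M j k\<bar>"] by (simp add: sum_nonneg)
    finally show ?thesis .
  qed
  moreover have "N \<ge> 0" unfolding N_def by (intro sum_nonneg) auto
  ultimately show ?thesis using that[of N] M order_trans by blast
qed

lemma disc_algebra_eq:
  assumes "disc_algebra u" "disc_algebra v" "\<And>l. cmod l = 1 \<Longrightarrow> u l = v l" "cmod l \<le> 1"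
  shows "u l = v l"
  using disc_algebra_bound[of "\<lambda>l. u l - v l" 0 l] assms by (auto intro: disc_algebra_intros)

text \<open>Applying the maximum principle to \<open>exp (\<i> u)\<close> and \<open>exp (- \<i> u)\<close> makes \<open>u\<close> real on the whole disc, and
  a real holomorphic function is constant because its image cannot be open.\<close>

lemma disc_algebra_real_boundary:
  assumes u: "disc_algebra u" and re: "\<And>l. cmod l = 1 \<Longrightarrow> Im (u l) = 0" and l: "cmod l \<le> 1"
  shows "u l = u 0"
proof -
  have Im0: "Im (u l) = 0" if "cmod l \<le> 1" for l
  proof -
    have "cmod (exp (c * u l)) \<le> 1" if "c = \<i> \<or> c = - \<i>" for c
      by (rule disc_algebra_bound[OF disc_algebra_exp])
         (use re u that \<open>cmod l \<le> 1\<close> in \<open>auto intro!: disc_algebra_intros\<close>)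
    from this[of \<i>] this[of "- \<i>"] show ?thesis by simp
  qed
  have "u constant_on ball 0 1"
  proof (rule ccontr)
    assume "\<not> u constant_on ball 0 1"
    then have "open (u ` ball 0 1)"
      using u by (intro open_mapping_thm[of u "ball 0 1"]) (auto simp: disc_algebra_def)
    then obtain e where e: "e > 0" "ball (u 0) e \<subseteq> u ` ball 0 1"
      by (meson centre_in_ball imageI open_contains_ball zero_less_one)
    have "u 0 + \<i> * (e/2) \<in> ball (u 0) e" using e by (simp add: dist_norm norm_mult)
    then obtain z where "z \<in> ball 0 1" "u 0 + \<i> * (e/2) = u z" using e by blast
    then show False using Im0[of z] Im0[of 0] e by (auto dest!: arg_cong[where f=Im])
  qed
  then have c: "u z = u 0" if "z \<in> ball 0 1" for z
    using that unfolding constant_on_def by (metis centre_in_ball zero_less_one)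
  have "continuous_on (closure (ball 0 1)) u" "l \<in> closure (ball 0 1)"
    using u l by (auto simp: disc_algebra_def)
  then show ?thesis
    using continuous_constant_on_closure[where f=u and S="ball 0 1" and a="u 0"] c by metis
qed

text \<open>A loop that is both positive and negative is constant: \<open>u + v\<close> and \<open>\<i> (u - v)\<close> are real on the
  circle.\<close>

lemma disc_algebra_rigid:
  assumes u: "disc_algebra u" and v: "disc_algebra v"
    and cnj: "\<And>l. cmod l = 1 \<Longrightarrow> u l = cnj (v l)" and l: "cmod l \<le> 1"
  shows "u l = u 0"
proof -
  have "u l + v l = u 0 + v 0"
    by (rule disc_algebra_real_boundary[where u="\<lambda>l. u l + v l"])
       (use u v cnj l in \<open>auto intro!: disc_algebra_intros\<close>)
  moreover have "\<i> * (u l - v l) = \<i> * (u 0 - v 0)"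
    by (rule disc_algebra_real_boundary[where u="\<lambda>l. \<i> * (u l - v l)"])
       (use u v cnj l in \<open>auto intro!: disc_algebra_intros\<close>)
  ultimately have "u l + v l = u 0 + v 0" "u l - v l = u 0 - v 0" by auto
  then show ?thesis by algebra
qed

section \<open>Laurent splitting by Cauchy integrals\<close>

text \<open>Inside the circle \<open>|s| = 1/2\<close> this is the nonnegative Laurent part of \<open>p\<close>; outside it is minus the
  negative part. Hence \<open>cauchy p 0\<close> is the constant coefficient, and one operator serves for both parts.\<close>

definition cauchy :: "(complex \<Rightarrow> complex) \<Rightarrow> complex \<Rightarrow> complex" where
  "cauchy p l = contour_integral (circlepath 0 (1/2)) (\<lambda>s. p s / (s - l)) / (2 * pi * \<i>)"

lemma cauchy_integrable:
  assumes "continuous_on (sphere 0 (1/2)) p" "cmod l \<noteq> 1/2"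
  shows "(\<lambda>s. p s / (s - l)) contour_integrable_on circlepath 0 (1/2)"
  using assms by (intro contour_integrable_continuous_circlepath continuous_intros) auto

lemma cauchy_diff:
  assumes "continuous_on (sphere 0 (1/2)) p" "continuous_on (sphere 0 (1/2)) q" "cmod l \<noteq> 1/2"
  shows "cauchy (\<lambda>s. p s - q s) l = cauchy p l - cauchy q l"
  using contour_integral_diff[OF cauchy_integrable[OF assms(1,3)] cauchy_integrable[OF assms(2,3)]]
  by (simp add: cauchy_def diff_divide_distrib)

lemma cauchy_bound:
  assumes "continuous_on (sphere 0 (1/2)) p" and "\<And>s. cmod s = 1/2 \<Longrightarrow> cmod (p s) \<le> e"
    and d: "d > 0" "\<And>s. cmod s = 1/2 \<Longrightarrow> d \<le> cmod (s - l)"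
  shows "cmod (cauchy p l) \<le> e / (2 * d)"
proof -
  have "cmod l \<noteq> 1/2" using d(2)[of l] d(1) by auto
  have e: "e \<ge> 0" using assms(2)[of "1/2"] norm_ge_zero order_trans by (metis norm_divide norm_numeral norm_one)
  have "cmod (contour_integral (circlepath 0 (1/2)) (\<lambda>s. p s / (s - l))) \<le> e / d * (2 * pi * (1/2))"
  proof (rule has_contour_integral_bound_circlepath)
    show "((\<lambda>s. p s / (s - l)) has_contour_integral contour_integral (circlepath 0 (1/2)) (\<lambda>s. p s / (s - l)))
       (circlepath 0 (1/2))"
      by (intro has_contour_integral_integral cauchy_integrable assms) fact
    fix s :: complex assume "cmod (s - 0) = 1/2"
    then show "cmod (p s / (s - l)) \<le> e / d"
      unfolding norm_divide using d e assms(2)[of s] by (intro frac_le) auto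
  qed (use d e in auto)
  then show ?thesis by (simp add: cauchy_def norm_divide norm_mult field_simps)
qed

lemma cauchy_disc_algebra_inside:
  assumes "disc_algebra u" "cmod l < 1/2"
  shows "cauchy u l = u l"
proof -
  have "u holomorphic_on cball 0 (1/2)"
    using assms by (auto simp: disc_algebra_def elim!: holomorphic_on_subset)
  from Cauchy_integral_circlepath_simple[OF this, of l] assms show ?thesis
    by (auto simp: cauchy_def dest!: contour_integral_unique)
qed

lemma cauchy_disc_algebra_outside:
  assumes "disc_algebra u" "cmod l = 1"
  shows "cauchy u l = 0"
proof -
  have "((\<lambda>s. u s / (s - l)) has_contour_integral 0) (circlepath 0 (1/2))"
    by (rule Cauchy_theorem_disc_simple[of _ 0 1])
       (use assms in \<open>auto simp: disc_algebra_def intro!: holomorphic_intros\<close>)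
  then show ?thesis by (simp add: cauchy_def contour_integral_unique)
qed

lemma cauchy_simple_pole:
  assumes "disc_algebra u" "cmod l = 1"
  shows "cauchy (\<lambda>s. u s / s) l = - u 0 / l"
proof -
  have "(\<lambda>s. u s / (s - l)) holomorphic_on cball 0 (1/2)"
    using assms by (auto simp: disc_algebra_def intro!: holomorphic_intros elim!: holomorphic_on_subset)
  from Cauchy_integral_circlepath_simple[OF this, of 0] show ?thesis
    by (auto simp: cauchy_def field_simps dest!: contour_integral_unique)
qed

text \<open>Only \<open>V / s\<close> has a negative Laurent part, and it is \<open>V 0 / l\<close>. The estimate is made on the circle
  \<open>|s| = 1/2\<close> but holds for the Cauchy integral on the unit circle, at no loss, because the two circles
  have distance \<open>1/2\<close>.\<close>

lemma cauchy_estimate_outside: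
  assumes p: "continuous_on (sphere 0 (1/2)) p" and U: "disc_algebra U" and V: "disc_algebra V"
    and le: "\<And>s. cmod s = 1/2 \<Longrightarrow> cmod (p s - U s - V s / s) \<le> e" and l: "cmod l = 1"
  shows "cmod (cauchy p l + V 0 / l) \<le> e"
proof -
  have U': "continuous_on (sphere 0 (1/2)) U" and V': "continuous_on (sphere 0 (1/2)) (\<lambda>s. V s / s)"
    using U V by (auto simp: disc_algebra_def intro!: continuous_intros elim!: continuous_on_subset)
  have "cauchy (\<lambda>s. p s - U s - V s / s) l = cauchy p l + V 0 / l"
    using l by (simp add: cauchy_diff p U' V' continuous_on_diff cauchy_disc_algebra_outside[OF U]
        cauchy_simple_pole[OF V])
  moreover have "cmod (cauchy (\<lambda>s. p s - U s - V s / s) l) \<le> e / (2 * (1/2))"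
  proof (rule cauchy_bound)
    show "continuous_on (sphere 0 (1/2)) (\<lambda>s. p s - U s - V s / s)"
      by (intro continuous_on_diff p U' V')
    show "1/2 \<le> cmod (s - l)" if "cmod s = 1/2" for s
      using that l norm_triangle_ineq2[of l s] by (simp add: norm_minus_commute)
  qed (use le in auto)
  ultimately show ?thesis by simp
qed

lemma cauchy_estimate_center:
  assumes p: "continuous_on (sphere 0 (1/2)) p" and U: "disc_algebra U"
    and le: "\<And>s. cmod s = 1/2 \<Longrightarrow> cmod (p s - U s) \<le> e"
  shows "cmod (cauchy p 0 - U 0) \<le> e"
proof -
  have U': "continuous_on (sphere 0 (1/2)) U"
    using U by (auto simp: disc_algebra_def elim!: continuous_on_subset)
  have "cauchy (\<lambda>s. p s - U s) 0 = cauchy p 0 - U 0"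
    by (simp add: cauchy_diff p U' cauchy_disc_algebra_inside[OF U])
  moreover have "cmod (cauchy (\<lambda>s. p s - U s) 0) \<le> e / (2 * (1/2))"
    by (rule cauchy_bound) (use le p U' in \<open>auto intro!: continuous_intros\<close>)
  ultimately show ?thesis by simp
qed

lemma cauchy_has_derivative_outside:
  assumes "continuous_on (sphere 0 (1/2)) p" "cmod l > 1/2"
  shows "cauchy p field_differentiable at l"
proof -
  have "((\<lambda>l. contour_integral (circlepath 0 (1/2)) (\<lambda>s. p s / (s - l))) has_field_derivative
      (of_nat 1 * contour_integral (circlepath 0 (1/2)) (\<lambda>s. p s / (s - l) ^ Suc 1))) (at l)"
  proof (rule Cauchy_next_derivative(2)[where S="UNIV" and B=pi])
    fix w :: complex assume "w \<in> UNIV - path_image (circlepath 0 (1/2))"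
    then show "((\<lambda>u. p u / (u - w) ^ 1) has_contour_integral
          contour_integral (circlepath 0 (1/2)) (\<lambda>s. p s / (s - w))) (circlepath 0 (1/2))"
      using has_contour_integral_integral[OF cauchy_integrable[OF assms(1)], of w] by simp
  qed (use assms in \<open>auto simp: vector_derivative_circlepath norm_mult\<close>)
  then have "(\<lambda>l. contour_integral (circlepath 0 (1/2)) (\<lambda>s. p s / (s - l)) / (2 * pi * \<i>))
     field_differentiable at l"
    by (intro derivative_intros) (auto simp: field_differentiable_def)
  then show ?thesis by (simp add: cauchy_def[abs_def])
qed

text \<open>The negative Laurent part is holomorphic outside \<open>|s| = 1/2\<close> and vanishes at infinity, so its
  reflection in the unit circle, which conjugates its boundary values, lies in the disc algebra.\<close>

lemma disc_algebra_cauchy_reflected: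
  assumes p: "continuous_on (sphere 0 (1/2)) p"
  shows "disc_algebra (\<lambda>l. if l = 0 then 0 else cnj (cauchy p (1 / cnj l)))"
proof -
  define M where "M = (\<lambda>m. if m = 0 then 0 else cauchy p (1 / m))"
  have holM: "M holomorphic_on ball 0 2 - {0}"
  proof -
    have "(cauchy p \<circ> (\<lambda>m. 1 / m)) holomorphic_on ball 0 2 - {0}"
    proof (rule holomorphic_on_compose)
      show "cauchy p holomorphic_on (\<lambda>m. 1 / m) ` (ball 0 2 - {0})"
        unfolding holomorphic_on_def
        by (auto intro!: field_differentiable_at_within cauchy_has_derivative_outside[OF p]
              simp: norm_divide divide_less_eq less_divide_eq split: if_splits)
    qed (auto intro!: holomorphic_intros)
    then show ?thesis by (rule holomorphic_transform) (auto simp: M_def)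
  qed
  obtain e where e: "\<And>s. cmod s = 1/2 \<Longrightarrow> cmod (p s) \<le> e"
    using compact_imp_bounded[OF compact_continuous_image[OF p]] by (force simp: bounded_iff)
  have bound: "cmod (M m) \<le> e * cmod m" if "cmod m < 1" for m
  proof (cases "m = 0")
    case False
    have "cmod (cauchy p (1 / m)) \<le> e / (2 * (1 / (2 * cmod m)))"
    proof (rule cauchy_bound[OF p e])
      fix s :: complex assume s: "cmod s = 1/2"
      have "1 / cmod m - 1/2 \<le> cmod (s - 1/m)"
        using norm_triangle_ineq2[of "1/m" s] s by (simp add: norm_divide norm_minus_commute)
      moreover have "1 / (2 * cmod m) \<le> 1 / cmod m - 1/2"
        using False that by (simp add: field_simps)
      ultimately show "1 / (2 * cmod m) \<le> cmod (s - 1/m)" by linarith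
    qed (use False in auto)
    then show ?thesis using False by (simp add: M_def)
  qed (simp add: M_def)
  have "(M \<longlongrightarrow> 0) (at 0)"
  proof (rule Lim_null_comparison)
    show "\<forall>\<^sub>F m in at 0. cmod (M m) \<le> e * cmod m"
      using bound by (auto simp: eventually_at intro!: exI[of _ 1])
    show "((\<lambda>m. e * cmod m) \<longlongrightarrow> 0) (at 0)" by (auto intro!: tendsto_eq_intros)
  qed
  then have "isCont M 0" by (simp add: isCont_def M_def)
  moreover have "isCont M m" if "m \<in> ball 0 2 - {0}" for m
    using holomorphic_on_imp_continuous_on[OF holM] that
    by (simp add: continuous_on_eq_continuous_at open_delete)
  ultimately have "continuous_on (ball 0 2) M"
    by (metis DiffI continuous_at_imp_continuous_on singletonD)
  then have M: "M holomorphic_on ball 0 2"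
    by (rule no_isolated_singularity[OF _ holM]) auto
  have "cnj \<circ> M \<circ> cnj holomorphic_on ball 0 2"
    by (rule holomorphic_on_compose_cnj_cnj) (use M in \<open>auto elim!: holomorphic_on_subset\<close>)
  moreover have "cnj \<circ> M \<circ> cnj = (\<lambda>l. if l = 0 then 0 else cnj (cauchy p (1 / cnj l)))"
    by (auto simp: M_def fun_eq_iff)
  ultimately have "(\<lambda>l. if l = 0 then 0 else cnj (cauchy p (1 / cnj l))) holomorphic_on ball 0 2"
    by simp
  then show ?thesis unfolding disc_algebra_def
    by (auto elim!: holomorphic_on_subset intro!: holomorphic_on_imp_continuous_on)
qed

lemma contour_integral_annulus:
  assumes "g holomorphic_on {s. 1/4 < cmod s \<and> cmod s < 1}"
  shows "contour_integral (circlepath 0 (1/2)) g = contour_integral (circlepath 0 (3/4)) g"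
proof (rule Cauchy_theorem_homotopic_loops[OF _ _ assms])
  show "homotopic_loops {s. 1/4 < cmod s \<and> cmod s < 1} (circlepath 0 (1/2)) (circlepath 0 (3/4))"
  proof (rule homotopic_loops_linear)
    fix t :: real assume "t \<in> {0..1}"
    show "closed_segment (circlepath 0 (1/2) t) (circlepath 0 (3/4) t)
      \<subseteq> {s. 1/4 < cmod s \<and> cmod s < 1}"
    proof
      fix x assume "x \<in> closed_segment (circlepath 0 (1/2) t) (circlepath 0 (3/4) t)"
      then obtain v where v: "0 \<le> v" "v \<le> 1"
        and x: "x = (1 - v) *\<^sub>R circlepath 0 (1/2) t + v *\<^sub>R circlepath 0 (3/4) t"
        by (auto simp: closed_segment_def)
      have "x = of_real ((2 + v) / 4) * exp (2 * of_real pi * \<i> * t)"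
        unfolding x by (simp add: circlepath scaleR_conv_of_real field_simps)
      moreover have "cmod (exp (2 * of_real pi * \<i> * t)) = 1" by simp
      ultimately have "cmod x = (2 + v) / 4" using v by (simp only: norm_mult norm_of_real) simp
      then show "x \<in> {s. 1/4 < cmod s \<and> cmod s < 1}" using v by simp
    qed
  qed auto
  have "{s::complex. 1/4 < cmod s \<and> cmod s < 1} = ball 0 1 - cball 0 (1/4)" by auto
  then show "open {s::complex. 1/4 < cmod s \<and> cmod s < 1}" by (simp add: open_Diff)
qed auto

text \<open>Subtracting the negative Laurent part from \<open>p\<close> leaves a function that extends to the disc: close to
  the centre it is the Cauchy integral over a larger circle, and on the overlap the two expressions
  agree by Cauchy's formula in an annulus.\<close>

lemma laurent_plus_part:
  assumes cont: "continuous_on {l. 1/4 < cmod l \<and> cmod l \<le> 1} p"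
    and hol: "p holomorphic_on {l. 1/4 < cmod l \<and> cmod l < 1}"
  obtains u where "disc_algebra u" "u 0 = cauchy p 0" "\<And>l. cmod l = 1 \<Longrightarrow> u l = p l + cauchy p l"
proof -
  define I where "I l = contour_integral (circlepath 0 (3/4)) (\<lambda>s. p s / (s - l)) / (2 * pi * \<i>)" for l
  have ann: "{s::complex. 1/4 < cmod s \<and> cmod s < 1} = ball 0 1 - cball 0 (1/4)" by auto
  have ann': "{s::complex. 1/2 < cmod s \<and> cmod s < 1} = ball 0 1 - cball 0 (1/2)" by auto
  have cont2: "continuous_on (sphere 0 (1/2)) p" and cont3: "continuous_on (sphere 0 (3/4)) p"
    by (rule continuous_on_subset[OF cont]; auto)+
  have int: "((\<lambda>s. p s / (s - l)) has_contour_integral 2 * pi * \<i> * I l) (circlepath 0 (3/4))"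
    if "cmod l < 3/4" for l
  proof -
    have "(\<lambda>s. p s / (s - l)) contour_integrable_on circlepath 0 (3/4)"
      using cont3 that by (intro contour_integrable_continuous_circlepath continuous_intros) auto
    then show ?thesis using has_contour_integral_integral by (simp add: I_def)
  qed
  have I_hol: "I holomorphic_on ball 0 (3/4)"
  proof -
    have "((\<lambda>l. 2 * pi * \<i> * I l) has_field_derivative
      (of_nat 1 * contour_integral (circlepath 0 (3/4)) (\<lambda>s. p s / (s - l) ^ Suc 1))) (at l)"
      if "l \<in> ball 0 (3/4)" for l
      by (rule Cauchy_next_derivative_circlepath(2)) (use cont3 int that in auto)
    then have "(\<lambda>l. 2 * pi * \<i> * I l) holomorphic_on ball 0 (3/4)"
      unfolding holomorphic_on_open[OF open_ball] by blast
    then have "(\<lambda>l. 1 / (2 * pi * \<i>) * (2 * pi * \<i> * I l)) holomorphic_on ball 0 (3/4)"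
      by (rule holomorphic_on_mult[OF holomorphic_on_const])
    then show ?thesis by (rule holomorphic_transform) simp
  qed
  have I0: "I 0 = cauchy p 0"
  proof -
    have "(\<lambda>s. p s / (s - 0)) holomorphic_on {s. 1/4 < cmod s \<and> cmod s < 1}"
      by (intro holomorphic_intros hol) auto
    from contour_integral_annulus[OF this] show ?thesis by (simp add: I_def cauchy_def)
  qed
  have overlap: "I l = p l + cauchy p l" if l: "1/2 < cmod l" "cmod l < 3/4" for l
  proof -
    \<comment> \<open>The difference quotient has no pole, so its integrals over the two circles agree.\<close>
    define g where "g = (\<lambda>s. if s = l then deriv p l else (p s - p l) / (s - l))"
    have "g holomorphic_on {s. 1/4 < cmod s \<and> cmod s < 1}"
      unfolding g_def by (rule pole_lemma_open[OF hol]) (simp only: ann open_Diff open_ball closed_cball)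
    note eq = contour_integral_annulus[OF this]
    have 1: "((\<lambda>s. 1 / (s - l)) has_contour_integral 2 * pi * \<i> * 1) (circlepath 0 (3/4))"
      using Cauchy_integral_circlepath_simple[of "\<lambda>_. 1" 0 "3/4" l] l by simp
    have 2: "((\<lambda>s. 1 / (s - l)) has_contour_integral 0) (circlepath 0 (1/2))"
      by (rule Cauchy_theorem_disc_simple[of _ 0 "cmod l"])
         (use l in \<open>auto intro!: holomorphic_intros\<close>)
    have "((\<lambda>s. p s / (s - l) - p l * (1 / (s - l))) has_contour_integral
       2 * pi * \<i> * I l - p l * (2 * pi * \<i> * 1)) (circlepath 0 (3/4))"
      by (intro has_contour_integral_diff has_contour_integral_lmul int 1 l)
    then have 3: "(g has_contour_integral 2 * pi * \<i> * I l - p l * (2 * pi * \<i> * 1)) (circlepath 0 (3/4))"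
      by (rule has_contour_integral_eq) (use l in \<open>auto simp: g_def diff_divide_distrib\<close>)
    have "((\<lambda>s. p s / (s - l)) has_contour_integral 2 * pi * \<i> * cauchy p l) (circlepath 0 (1/2))"
      using has_contour_integral_integral[OF cauchy_integrable[OF cont2, of l]] l by (simp add: cauchy_def)
    from has_contour_integral_diff[OF this has_contour_integral_lmul[OF 2, of "p l"]]
    have "(g has_contour_integral 2 * pi * \<i> * cauchy p l - p l * 0) (circlepath 0 (1/2))"
      by (rule has_contour_integral_eq) (use l in \<open>auto simp: g_def diff_divide_distrib\<close>)
    with 3 eq have "2 * pi * \<i> * I l - p l * (2 * pi * \<i> * 1) = 2 * pi * \<i> * cauchy p l - p l * 0"
      by (simp add: contour_integral_unique)
    then have "2 * pi * \<i> * I l = 2 * pi * \<i> * (p l + cauchy p l)" by (simp add: algebra_simps)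
    then show ?thesis by simp
  qed
  have c_hol: "cauchy p holomorphic_on {l. 1/2 < cmod l}"
    unfolding holomorphic_on_def using cauchy_has_derivative_outside[OF cont2]
    by (auto intro: field_differentiable_at_within)
  define u where "u l = (if cmod l < 3/4 then I l else p l + cauchy p l)" for l
  have u1: "u l = I l" if "cmod l < 3/4" for l using that by (simp add: u_def)
  have u2: "u l = p l + cauchy p l" if "1/2 < cmod l" for l using overlap that by (simp add: u_def)
  have "u holomorphic_on ball 0 (3/4) \<union> {l. 1/2 < cmod l \<and> cmod l < 1}"
  proof (rule holomorphic_on_Un)
    show "u holomorphic_on ball 0 (3/4)"
      by (rule holomorphic_transform[OF I_hol]) (simp add: u1)
    have "(\<lambda>l. p l + cauchy p l) holomorphic_on {l. 1/2 < cmod l \<and> cmod l < 1}"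
      by (intro holomorphic_intros; rule holomorphic_on_subset[OF hol] holomorphic_on_subset[OF c_hol]; auto)
    then show "u holomorphic_on {l. 1/2 < cmod l \<and> cmod l < 1}"
      by (rule holomorphic_transform) (simp add: u2)
  qed (simp_all only: ann' open_Diff open_ball closed_cball)
  moreover have "ball 0 (3/4) \<union> {l::complex. 1/2 < cmod l \<and> cmod l < 1} = ball 0 1" by auto
  ultimately have "u holomorphic_on ball 0 1" by simp
  moreover have "continuous_on (ball 0 (3/4) \<union> {l. 1/2 < cmod l \<and> cmod l \<le> 1}) u"
  proof (rule continuous_on_Un_local_open)
    have eq: "ball 0 (3/4) \<union> {l::complex. 1/2 < cmod l \<and> cmod l \<le> 1} = cball 0 1" by auto
    have "ball 0 (3/4) = cball 0 1 \<inter> ball (0::complex) (3/4)" by auto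
    then show "openin (top_of_set (ball 0 (3/4) \<union> {l::complex. 1/2 < cmod l \<and> cmod l \<le> 1})) (ball 0 (3/4))"
      unfolding eq openin_open by blast
    have "{l::complex. 1/2 < cmod l \<and> cmod l \<le> 1} = cball 0 1 \<inter> - cball 0 (1/2)" by auto
    then show "openin (top_of_set (ball 0 (3/4) \<union> {l::complex. 1/2 < cmod l \<and> cmod l \<le> 1}))
       {l::complex. 1/2 < cmod l \<and> cmod l \<le> 1}"
      unfolding eq openin_open by (metis closed_cball open_Compl)
    show "continuous_on (ball 0 (3/4)) u"
      using holomorphic_on_imp_continuous_on[OF I_hol] by (rule continuous_on_eq) (simp add: u1)
    have "continuous_on {l. 1/2 < cmod l \<and> cmod l \<le> 1} (\<lambda>l. p l + cauchy p l)"
      by (intro continuous_intros; rule continuous_on_subset[OF cont]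
            continuous_on_subset[OF holomorphic_on_imp_continuous_on[OF c_hol]]; auto)
    then show "continuous_on {l. 1/2 < cmod l \<and> cmod l \<le> 1} u"
      by (rule continuous_on_eq) (simp add: u2)
  qed
  moreover have "ball 0 (3/4) \<union> {l::complex. 1/2 < cmod l \<and> cmod l \<le> 1} = cball 0 1" by auto
  ultimately have "disc_algebra u" by (simp add: disc_algebra_def)
  then show ?thesis using that[of u] u1[of 0] u2 I0 by simp
qed

text \<open>Split \<open>p\<close> and \<open>q\<close> into positive and negative parts. The relation \<open>p = cnj q\<close> then says that a disc
  algebra function, the positive part of \<open>p\<close> minus the conjugate of the negative part of \<open>q\<close>, is the
  conjugate of another one; by rigidity it is constant. So on the unit circle \<open>p\<close> is controlled by
  integrals over \<open>|s| = 1/2\<close>.\<close>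

lemma reality_formula:
  assumes p: "continuous_on {l. 1/4 < cmod l \<and> cmod l \<le> 1} p"
      "p holomorphic_on {l. 1/4 < cmod l \<and> cmod l < 1}"
    and q: "continuous_on {l. 1/4 < cmod l \<and> cmod l \<le> 1} q"
      "q holomorphic_on {l. 1/4 < cmod l \<and> cmod l < 1}"
    and cnj: "\<And>l. cmod l = 1 \<Longrightarrow> p l = cnj (q l)" and l: "cmod l = 1"
  shows "p l = cauchy p 0 - cauchy p l - cnj (cauchy q l)"
proof -
  obtain u where u: "disc_algebra u" "u 0 = cauchy p 0" "\<And>l. cmod l = 1 \<Longrightarrow> u l = p l + cauchy p l"
    by (rule laurent_plus_part[OF p]) blast
  obtain v where v: "disc_algebra v" "v 0 = cauchy q 0" "\<And>l. cmod l = 1 \<Longrightarrow> v l = q l + cauchy q l"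
    by (rule laurent_plus_part[OF q]) blast
  define r where "r f l = (if l = 0 then 0 else cnj (cauchy f (1 / cnj l)))" for f l
  have r: "disc_algebra (r p)" "disc_algebra (r q)"
    unfolding r_def[abs_def]
    by (rule disc_algebra_cauchy_reflected, rule continuous_on_subset[OF p(1)], auto)
       (rule disc_algebra_cauchy_reflected, rule continuous_on_subset[OF q(1)], auto)
  have r1: "r f l = cnj (cauchy f l)" if "cmod l = 1" for f l
  proof -
    have "l * cnj l = 1" using that by (simp add: complex_norm_square[symmetric])
    moreover have "l \<noteq> 0" using that by auto
    ultimately have "1 / cnj l = l" "l \<noteq> 0" by (simp_all add: divide_eq_eq)
    then show ?thesis by (simp add: r_def)
  qed
  have "u l + r q l = u 0 + r q 0"
  proof (rule disc_algebra_rigid[where u="\<lambda>l. u l + r q l" and v="\<lambda>l. v l + r p l"])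
    fix l :: complex assume "cmod l = 1"
    then show "u l + r q l = cnj (v l + r p l)" by (simp add: u v r1 cnj)
  qed (use u v r l in \<open>auto intro!: disc_algebra_intros\<close>)
  then show ?thesis using l u r1[OF l] by (simp add: r_def algebra_simps)
qed

section \<open>The transition matrix of a holomorphic potential\<close>

text \<open>The Taylor coefficients in \<open>w\<close> of a loop \<open>\<Sum>\<^sub>i x\<^sub>i(w) l\<^sup>i\<close> are positive loops. Cauchy's inequality in
  \<open>w\<close> transfers the uniform convergence from the loops to their coefficients on the unit circle, and
  the maximum principle in \<open>l\<close> carries it into the disc.\<close>

lemma taylor_coefficients_disc_algebra:
  fixes x :: "nat \<Rightarrow> complex \<Rightarrow> complex"
  assumes hol: "\<And>i. x i holomorphic_on cball z r" and r: "r > 0"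
    and lim: "uniform_limit (cball z r \<times> sphere 0 1) (\<lambda>n (w, l). \<Sum>i<n. x i w * l ^ i) X sequentially"
  obtains \<eta> M where "\<And>m. disc_algebra (\<eta> m)" "\<And>m l. cmod l \<le> 1 \<Longrightarrow> cmod (\<eta> m l) \<le> M / r ^ m"
    "\<eta> 0 0 = x 0 z" "\<And>l. cmod l = 1 \<Longrightarrow> (\<lambda>w. X (w, l)) holomorphic_on ball z r"
    "\<And>m l. cmod l = 1 \<Longrightarrow> \<eta> m l = (deriv ^^ m) (\<lambda>w. X (w, l)) z / fact m"
proof -
  define T where "T n w l = (\<Sum>i<n. x i w * l ^ i)" for n w and l :: complex
  have holT: "(\<lambda>w. T n w l) holomorphic_on cball z r" for n l
    unfolding T_def by (intro holomorphic_intros hol)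
  have hol': "x i holomorphic_on ball z r" for i
    by (rule holomorphic_on_subset[OF hol]) auto
  have holT': "(\<lambda>w. T n w l) holomorphic_on ball z r" for n l
    by (rule holomorphic_on_subset[OF holT]) auto
  define Y where "Y m n l = (\<Sum>i<n. (deriv ^^ m) (x i) z / fact m * l ^ i)" for m n and l :: complex
  have Y: "Y m n l = (deriv ^^ m) (\<lambda>w. T n w l) z / fact m" for m n l
  proof (induction n)
    case (Suc n)
    have "(deriv ^^ m) (\<lambda>w. T (Suc n) w l) z = (deriv ^^ m) (\<lambda>w. T n w l + x n w * l ^ n) z"
      by (simp add: T_def)
    also have "\<dots> = (deriv ^^ m) (\<lambda>w. T n w l) z + (deriv ^^ m) (\<lambda>w. x n w * l ^ n) z"
      using r by (intro higher_deriv_add[where S="ball z r"] holT' holomorphic_intros hol') auto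
    also have "(deriv ^^ m) (\<lambda>w. x n w * l ^ n) z = (deriv ^^ m) (x n) z * l ^ n"
      using r higher_deriv_cmult[where f="x n" and x=z and A="ball z r" and c="l ^ n" and j=m] hol'
      by (simp add: mult.commute)
    finally show ?case using Suc by (simp add: Y_def add_divide_distrib)
  qed (simp add: T_def Y_def)
  have diff: "cmod (Y m n l - Y m k l) \<le> e / r ^ m"
    if "\<And>w. w \<in> cball z r \<Longrightarrow> cmod (T n w l - T k w l) \<le> e" for m n k l e
  proof -
    have "cmod ((deriv ^^ m) (\<lambda>w. T n w l - T k w l) z) \<le> fact m * e / r ^ m"
      using that holT r
      by (intro Cauchy_inequality holomorphic_intros holT' continuous_intros
            holomorphic_on_imp_continuous_on[OF holT]) (auto simp: dist_norm)
    moreover have "(deriv ^^ m) (\<lambda>w. T n w l - T k w l) z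
        = (deriv ^^ m) (\<lambda>w. T n w l) z - (deriv ^^ m) (\<lambda>w. T k w l) z"
      using r by (intro higher_deriv_diff[where S="ball z r"] holT') auto
    ultimately show ?thesis
      by (simp add: Y diff_divide_distrib[symmetric] norm_divide divide_le_eq mult.commute)
  qed
  have Y_disc: "disc_algebra (Y m n)" for m n
    unfolding Y_def[abs_def] by (intro disc_algebra_intros)
  have "uniformly_convergent_on (cball 0 1) (Y m)" for m
  proof (rule Cauchy_uniformly_convergent, rule uniformly_Cauchy_onI)
    fix e :: real assume e: "e > 0"
    have "uniformly_Cauchy_on (cball z r \<times> sphere 0 1) (\<lambda>n (w, l). T n w l)"
      using lim by (intro uniformly_convergent_Cauchy) (auto simp: uniformly_convergent_on_def T_def)
    moreover have "e / 2 * r ^ m > 0" using e r by simp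
    ultimately obtain N where "\<forall>x\<in>cball z r \<times> sphere 0 1. \<forall>n\<ge>N. \<forall>k\<ge>N.
        dist (case x of (w, l) \<Rightarrow> T n w l) (case x of (w, l) \<Rightarrow> T k w l) < e / 2 * r ^ m"
      unfolding uniformly_Cauchy_on_def by meson
    then have N: "cmod (T n w l - T k w l) < e / 2 * r ^ m"
      if "w \<in> cball z r" "cmod l = 1" "n \<ge> N" "k \<ge> N" for w l n k
      using that by (force simp: dist_norm)
    have "dist (Y m n l) (Y m k l) < e" if "l \<in> cball 0 1" "n \<ge> N" "k \<ge> N" for n k l
    proof -
      have "cmod (Y m n l - Y m k l) \<le> e / 2"
      proof (rule disc_algebra_bound[where u="\<lambda>l. Y m n l - Y m k l"])
        show "disc_algebra (\<lambda>l. Y m n l - Y m k l)" by (intro disc_algebra_intros Y_disc)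
        fix l :: complex assume "cmod l = 1"
        then show "cmod (Y m n l - Y m k l) \<le> e / 2"
          using diff[of n l k "e / 2 * r ^ m" m] N[of _ l n k] that r by (simp add: less_imp_le)
      qed (use that in auto)
      then show ?thesis using e by (simp add: dist_norm)
    qed
    then show "\<exists>N. \<forall>l\<in>cball 0 1. \<forall>n\<ge>N. \<forall>k\<ge>N. dist (Y m n l) (Y m k l) < e" by blast
  qed
  then obtain \<eta> where \<eta>: "\<And>m. uniform_limit (cball 0 1) (Y m) (\<eta> m) sequentially"
    unfolding uniformly_convergent_on_def by metis
  have disc: "disc_algebra (\<eta> m)" for m
    by (rule disc_algebra_uniform_limit[OF Y_disc \<eta>])
  have lim_l: "uniform_limit (cball z r) (\<lambda>n w. T n w l) (\<lambda>w. X (w, l)) sequentially" if "cmod l = 1" for l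
    using lim that unfolding uniform_limit_iff T_def[symmetric]
    by (fastforce elim!: eventually_mono)
  have X: "(\<lambda>w. X (w, l)) holomorphic_on ball z r" "continuous_on (cball z r) (\<lambda>w. X (w, l))"
    if "cmod l = 1" for l
    using holomorphic_uniform_limit[OF _ lim_l[OF that]] holT' holomorphic_on_imp_continuous_on[OF holT]
    by (metis (no_types, lifting) always_eventually trivial_limit_sequentially)+
  have \<eta>_eq: "\<eta> m l = (deriv ^^ m) (\<lambda>w. X (w, l)) z / fact m" if l: "cmod l = 1" for m l
  proof (rule LIMSEQ_unique)
    show "(\<lambda>n. Y m n l) \<longlonglongrightarrow> \<eta> m l" using l by (intro tendsto_uniform_limitI[OF \<eta>]) simp
    have "(\<lambda>n. (deriv ^^ m) (\<lambda>w. T n w l) z) \<longlonglongrightarrow> (deriv ^^ m) (\<lambda>w. X (w, l)) z"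
      by (rule higher_deriv_complex_uniform_limit[where A="ball z r"])
         (use uniform_limit_on_subset[OF lim_l[OF l]] holT' r in auto)
    then show "(\<lambda>n. Y m n l) \<longlonglongrightarrow> (deriv ^^ m) (\<lambda>w. X (w, l)) z / fact m"
      unfolding Y by (intro tendsto_intros) auto
  qed
  have "continuous_on (cball z r \<times> sphere 0 1) X"
  proof (rule uniform_limit_theorem[OF _ lim])
    have "continuous_on (cball z r \<times> sphere 0 1) (\<lambda>p. x i (fst p))" for i
      by (rule continuous_on_compose2[OF holomorphic_on_imp_continuous_on[OF hol]])
         (auto intro!: continuous_intros)
    then show "\<forall>\<^sub>F n in sequentially.
        continuous_on (cball z r \<times> sphere 0 1) (\<lambda>(w, l). \<Sum>i<n. x i w * l ^ i)"
      by (auto simp: case_prod_beta intro!: always_eventually continuous_intros)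
  qed auto
  then have "bounded (X ` (cball z r \<times> sphere 0 1))"
    by (intro compact_imp_bounded compact_continuous_image compact_Times) auto
  then obtain M where M: "\<And>w l. w \<in> cball z r \<Longrightarrow> cmod l = 1 \<Longrightarrow> cmod (X (w, l)) \<le> M"
    by (force simp: bounded_iff)
  have bound: "cmod (\<eta> m l) \<le> M / r ^ m" if "cmod l \<le> 1" for m l
  proof (rule disc_algebra_bound[OF disc _ that])
    fix l :: complex assume l: "cmod l = 1"
    have "cmod ((deriv ^^ m) (\<lambda>w. X (w, l)) z) \<le> fact m * M / r ^ m"
      using r M l by (intro Cauchy_inequality X) (auto simp: dist_norm)
    then show "cmod (\<eta> m l) \<le> M / r ^ m"
      using l by (simp add: \<eta>_eq norm_divide divide_le_eq mult.commute)
  qed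
  have "\<eta> 0 0 = x 0 z"
  proof (rule LIMSEQ_unique)
    show "(\<lambda>n. Y 0 n 0) \<longlonglongrightarrow> \<eta> 0 0" by (intro tendsto_uniform_limitI[OF \<eta>]) simp
    have "Y 0 (Suc n) 0 = x 0 z" for n by (simp add: Y_def sum.lessThan_Suc_shift)
    then show "(\<lambda>n. Y 0 n 0) \<longlonglongrightarrow> x 0 z" by (subst filterlim_sequentially_Suc[symmetric]) simp
  qed
  with that disc bound X(1) \<eta>_eq show ?thesis by blast
qed

text \<open>The power series solution \<open>\<Sum>\<^sub>n T\<^sub>n(l) (h / l)\<^sup>n\<close> of \<open>P' = P X / l\<close>, \<open>P = 1\<close> at \<open>h = 0\<close>, when \<open>X\<close> has the
  Taylor coefficients \<open>\<eta> m\<close>. The factor \<open>l\<^sup>-\<^sup>n\<close>, which comes from the pole of the potential, is split off so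
  that the coefficients stay in the disc algebra.\<close>

fun transition_coeff :: "(nat \<Rightarrow> 2 \<Rightarrow> 2 \<Rightarrow> complex \<Rightarrow> complex) \<Rightarrow> nat \<Rightarrow> 2 \<Rightarrow> 2 \<Rightarrow> complex \<Rightarrow> complex" where
  "transition_coeff \<eta> 0 j k l = (if j = k then 1 else 0)"
| "transition_coeff \<eta> (Suc n) j k l =
     (\<Sum>m\<le>n. l ^ (n - m) * (\<Sum>i\<in>UNIV. transition_coeff \<eta> m j i l * \<eta> (n - m) i k l)) / of_nat (Suc n)"

lemma transition_coeff_disc_algebra:
  assumes "\<And>m i k. disc_algebra (\<eta> m i k)"
  shows "disc_algebra (transition_coeff \<eta> n j k)"
proof (induction n arbitrary: j k rule: less_induct)
  case (less n)
  show ?case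
  proof (cases n)
    case 0
    then show ?thesis using disc_algebra_const by simp
  next
    case (Suc p)
    have "disc_algebra (\<lambda>l. (\<Sum>m\<le>p. l ^ (p - m) *
        (\<Sum>i\<in>UNIV. transition_coeff \<eta> m j i l * \<eta> (p - m) i k l)) * (1 / of_nat (Suc p)))"
      by (intro disc_algebra_intros less assms) (use Suc in auto)
    then show ?thesis using Suc by simp
  qed
qed

text \<open>Majorant argument: each of the \<open>n + 1\<close> summands of the recursion is at most \<open>Q\<^sup>n\<^sup>+\<^sup>1\<close>, and the division
  by \<open>n + 1\<close> compensates for their number.\<close>

lemma transition_coeff_bound:
  assumes \<eta>: "\<And>m i k. cmod (\<eta> m i k l) \<le> M / r ^ m" and r: "r > 0"
    and Q: "2 * M \<le> Q" "1 / r \<le> Q" and l: "cmod l \<le> 1"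
  shows "cmod (transition_coeff \<eta> n j k l) \<le> Q ^ n"
proof (induction n arbitrary: j k rule: less_induct)
  case (less n)
  have Q0: "Q \<ge> 0" using Q r by (meson divide_nonneg_pos order_trans zero_le_one)
  show ?case
  proof (cases n)
    case (Suc p)
    have M0: "M \<ge> 0" using \<eta>[of 0] by (metis div_by_1 norm_ge_zero order_trans power_0)
    have summand: "cmod (l ^ (p - m) * (\<Sum>i\<in>UNIV. transition_coeff \<eta> m j i l * \<eta> (p - m) i k l)) \<le> Q ^ Suc p"
      if m: "m \<le> p" for m
    proof -
      have "cmod (transition_coeff \<eta> m j i l * \<eta> (p - m) i k l) \<le> Q ^ m * (M * Q ^ (p - m))" for i
      proof -
        have "M / r ^ (p - m) = M * (1 / r) ^ (p - m)" by (simp add: power_inverse divide_inverse)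
        also have "\<dots> \<le> M * Q ^ (p - m)" using Q r M0 by (intro mult_left_mono power_mono) auto
        finally show ?thesis
          unfolding norm_mult using \<eta>[of "p - m" i k] m Suc less[of m j i] Q0
          by (intro mult_mono) (auto intro: order_trans)
      qed
      then have "cmod (\<Sum>i\<in>UNIV. transition_coeff \<eta> m j i l * \<eta> (p - m) i k l)
          \<le> of_nat (card (UNIV :: 2 set)) * (Q ^ m * (M * Q ^ (p - m)))"
        by (intro sum_norm_bound)
      also have "\<dots> = 2 * M * Q ^ p" using m by (simp add: power_add[symmetric])
      also have "\<dots> \<le> Q * Q ^ p" using Q Q0 by (intro mult_right_mono) auto
      finally have "cmod (\<Sum>i\<in>UNIV. transition_coeff \<eta> m j i l * \<eta> (p - m) i k l) \<le> Q ^ Suc p" by simp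
      moreover have "cmod l ^ (p - m) \<le> 1" using l by (simp add: power_le_one)
      ultimately show ?thesis unfolding norm_mult norm_power
        using mult_mono[of "cmod l ^ (p - m)" 1] by fastforce
    qed
    have "cmod (\<Sum>m\<le>p. l ^ (p - m) * (\<Sum>i\<in>UNIV. transition_coeff \<eta> m j i l * \<eta> (p - m) i k l))
        \<le> of_nat (card {..p}) * Q ^ Suc p"
      by (intro sum_norm_bound summand) auto
    then show ?thesis unfolding Suc transition_coeff.simps norm_divide norm_of_nat
      by (simp add: divide_le_eq mult.commute del: of_nat_Suc)
  qed auto
qed

text \<open>Comparing Taylor coefficients on both sides of the differential equation. This replaces an existence
  and uniqueness theorem: the solution is given for \<open>|l| = 1\<close>, and its coefficients are seen to be
  those of a series that also makes sense for \<open>|l| < 1\<close>.\<close>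

lemma taylor_coeff_linear_ode:
  fixes C X :: "2 \<Rightarrow> 2 \<Rightarrow> complex \<Rightarrow> complex"
  assumes X: "\<And>i k. X i k holomorphic_on ball z r" and r: "r > 0" and l: "l \<noteq> 0"
    and ode: "\<And>j k w. w \<in> ball z r \<Longrightarrow>
       (C j k has_field_derivative (\<Sum>i\<in>UNIV. C j i w * X i k w) / l) (at w)"
    and \<eta>: "\<And>m i k. \<eta> m i k l = (deriv ^^ m) (X i k) z / fact m"
  shows "l ^ n * ((deriv ^^ n) (C j k) z / fact n) = (\<Sum>a\<in>UNIV. C j a z * transition_coeff \<eta> n a k l)"
proof (induction n arbitrary: j k rule: less_induct)
  case (less n)
  have holC: "C j k holomorphic_on ball z r" for j k
    unfolding holomorphic_on_open[OF open_ball] using ode by blast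
  show ?case
  proof (cases n)
    case 0
    then show ?thesis by (simp add: if_distrib[of "(*) _"] cong: if_cong)
  next
    case (Suc p)
    define c where "c m j k = (deriv ^^ m) (C j k) z / fact m" for m j k
    have IH: "l ^ m * c m j i = (\<Sum>a\<in>UNIV. C j a z * transition_coeff \<eta> m a i l)" if "m \<le> p" for m i
      using less[of m j i] that Suc by (simp add: c_def)
    have prod: "(deriv ^^ p) (\<lambda>w. C j i w * X i k w) z / fact p = (\<Sum>m\<le>p. c m j i * \<eta> (p - m) i k l)" for i
    proof -
      have "(deriv ^^ p) (\<lambda>w. C j i w * X i k w) z
          = (\<Sum>m=0..p. of_nat (p choose m) * (deriv ^^ m) (C j i) z * (deriv ^^ (p - m)) (X i k) z)"
        using r by (intro higher_deriv_mult[where S="ball z r"] holC X) auto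
      also have "\<dots> / fact p = (\<Sum>m\<le>p. c m j i * \<eta> (p - m) i k l)"
        unfolding sum_divide_distrib atMost_atLeast0
        by (intro sum.cong) (auto simp: c_def \<eta> binomial_fact field_simps)
      finally show ?thesis .
    qed
    have "(deriv ^^ Suc p) (C j k) z = (deriv ^^ p) (deriv (C j k)) z"
      by (simp only: funpow_Suc_right o_apply)
    also have "\<dots> = (deriv ^^ p) (\<lambda>w. (1 / l) * (C j 1 w * X 1 k w + C j 2 w * X 2 k w)) z"
    proof (rule higher_deriv_transform_within_open[where S="ball z r"])
      show "deriv (C j k) holomorphic_on ball z r" by (intro holomorphic_deriv holC) auto
      fix w assume "w \<in> ball z r"
      from DERIV_imp_deriv[OF ode[OF this]]
      show "deriv (C j k) w = (1 / l) * (C j 1 w * X 1 k w + C j 2 w * X 2 k w)"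
        by (simp add: sum_2)
    qed (use r in \<open>auto intro!: holomorphic_intros holC X\<close>)
    also have "\<dots> = (1 / l) * ((deriv ^^ p) (\<lambda>w. C j 1 w * X 1 k w) z + (deriv ^^ p) (\<lambda>w. C j 2 w * X 2 k w) z)"
      using r by (subst higher_deriv_cmult[where A="ball z r"])
        (auto intro!: holomorphic_intros holC X higher_deriv_add[where S="ball z r"])
    also have "\<dots> = fact p / l * (\<Sum>i\<in>UNIV. (deriv ^^ p) (\<lambda>w. C j i w * X i k w) z / fact p)"
      unfolding sum_2 add_divide_distrib[symmetric] by simp
    also have "\<dots> = fact p / l * (\<Sum>i\<in>UNIV. \<Sum>m\<le>p. c m j i * \<eta> (p - m) i k l)"
      by (simp only: prod)
    finally have "l ^ n * ((deriv ^^ n) (C j k) z / fact n)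
        = (\<Sum>i\<in>UNIV. \<Sum>m\<le>p. l ^ p * (c m j i * \<eta> (p - m) i k l)) / of_nat (Suc p)"
      using l unfolding Suc sum_distrib_left[symmetric] by simp
    also have "(\<Sum>i\<in>UNIV. \<Sum>m\<le>p. l ^ p * (c m j i * \<eta> (p - m) i k l))
        = (\<Sum>i\<in>UNIV. \<Sum>m\<le>p. l ^ (p - m) * ((\<Sum>a\<in>UNIV. C j a z * transition_coeff \<eta> m a i l) * \<eta> (p - m) i k l))"
    proof (intro sum.cong refl)
      fix i m assume "m \<in> {..p}"
      then have "l ^ p = l ^ (p - m) * l ^ m" by (simp add: power_add[symmetric])
      then show "l ^ p * (c m j i * \<eta> (p - m) i k l)
         = l ^ (p - m) * ((\<Sum>a\<in>UNIV. C j a z * transition_coeff \<eta> m a i l) * \<eta> (p - m) i k l)"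
        using IH[of m i] \<open>m \<in> {..p}\<close> by (simp add: mult_ac flip: IH)
    qed
    also have "\<dots> / of_nat (Suc p) = (\<Sum>a\<in>UNIV. C j a z * transition_coeff \<eta> (Suc p) a k l)"
      unfolding transition_coeff.simps sum_2 times_divide_eq_right add_divide_distrib[symmetric]
        sum_distrib_left sum.distrib[symmetric]
      by (simp add: algebra_simps)
    finally show ?thesis by (simp only: Suc)
  qed
qed

lemma potential_partial_shift:
  fixes \<xi> :: "int \<Rightarrow> complex \<Rightarrow> complex^2^2"
  assumes "l \<noteq> 0"
  shows "(\<Sum>i<m + 2. \<xi> (int i - 1) w $ j $ k * l ^ i) = l * potential_partial \<xi> m w l $ j $ k"
proof -
  have "(\<Sum>i\<in>{-1..int m}. \<xi> i w $ j $ k * l powi i) = (\<Sum>i<m + 2. \<xi> (int i - 1) w $ j $ k * l powi (int i - 1))"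
    by (rule sum.reindex_bij_witness[of _ "\<lambda>i. int i - 1" "\<lambda>i. nat (i + 1)"]) auto
  moreover have "l powi (int i - 1) = l ^ i / l" for i
    using assms power_int_diff[of l "int i" 1] by simp
  ultimately show ?thesis
    using assms unfolding potential_partial_def vec_lambda_beta by (simp only: sum_distrib_left) simp
qed

lemma potential_uniform_limit:
  fixes \<xi> :: "int \<Rightarrow> complex \<Rightarrow> complex^2^2" and L :: "complex \<times> complex \<Rightarrow> complex^2^2"
  assumes "uniform_limit (A \<times> sphere 0 1) (\<lambda>n (w, l). potential_partial \<xi> n w l) L sequentially"
  shows "uniform_limit (A \<times> sphere 0 1) (\<lambda>n (w, l). \<Sum>i<n. \<xi> (int i - 1) w $ j $ k * l ^ i)
    (\<lambda>(w, l). l * L (w, l) $ j $ k) sequentially"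
  unfolding uniform_limit_iff
proof (intro allI impI)
  fix e :: real assume "e > 0"
  with assms obtain N where N: "\<And>n w l. n \<ge> N \<Longrightarrow> w \<in> A \<Longrightarrow> cmod l = 1 \<Longrightarrow>
      dist (potential_partial \<xi> n w l) (L (w, l)) < e"
    unfolding uniform_limit_iff eventually_sequentially by fastforce
  have "cmod ((\<Sum>i<n. \<xi> (int i - 1) w $ j $ k * l ^ i) - l * L (w, l) $ j $ k) < e"
    if n: "n \<ge> N + 2" and w: "w \<in> A" and l: "cmod l = 1" for n w l
  proof -
    obtain m where m: "n = m + 2" "m \<ge> N" using n by (metis add_le_cancel_right le_Suc_ex add.commute add.assoc le_add1)
    have "(\<Sum>i<n. \<xi> (int i - 1) w $ j $ k * l ^ i) - l * L (w, l) $ j $ k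
        = l * ((potential_partial \<xi> m w l - L (w, l)) $ j $ k)"
      using l unfolding m by (subst potential_partial_shift) (auto simp: algebra_simps)
    also have "cmod \<dots> \<le> norm (potential_partial \<xi> m w l - L (w, l))"
      using l order_trans[OF Finite_Cartesian_Product.norm_nth_le Finite_Cartesian_Product.norm_nth_le]
      by (simp add: norm_mult del: vector_minus_component)
    also have "\<dots> < e" using N[OF m(2) w l] by (simp add: dist_norm)
    finally show ?thesis .
  qed
  then show "\<forall>\<^sub>F n in sequentially. \<forall>x\<in>A \<times> sphere 0 1.
      dist (case x of (w, l) \<Rightarrow> \<Sum>i<n. \<xi> (int i - 1) w $ j $ k * l ^ i)
        (case x of (w, l) \<Rightarrow> l * L (w, l) $ j $ k) < e"
    unfolding eventually_sequentially by (intro exI[of _ "N + 2"]) (auto simp: dist_norm)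
qed

text \<open>The bound on \<open>h\<close> makes the ratio \<open>Q |h / l|\<close> at most \<open>1/2\<close> on the annulus \<open>1/4 < |l| \<le> 1\<close>, so the series
  is dominated there by a geometric one.\<close>

lemma power_series_loop:
  fixes t :: "nat \<Rightarrow> complex \<Rightarrow> complex"
  assumes t: "\<And>n. disc_algebra (t n)" and bound: "\<And>n l. cmod l \<le> 1 \<Longrightarrow> cmod (t n l) \<le> Q ^ n"
    and Q: "Q > 0" and h: "cmod h < 1 / (8 * Q)"
  defines "S \<equiv> \<lambda>l. \<Sum>n. t n l * (h / l) ^ n"
  shows "continuous_on {l. 1/4 < cmod l \<and> cmod l \<le> 1} S" (is ?th1)
    and "S holomorphic_on {l. 1/4 < cmod l \<and> cmod l < 1}" (is ?th2)
    and "\<And>l. 1/4 < cmod l \<Longrightarrow> cmod l \<le> 1 \<Longrightarrow> (\<lambda>n. t n l * (h / l) ^ n) sums S l"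
    and "\<And>l. 1/4 < cmod l \<Longrightarrow> cmod l \<le> 1 \<Longrightarrow> cmod (S l) \<le> 2"
    and "\<And>l. cmod l = 1/2 \<Longrightarrow> cmod (S l - t 0 l - t 1 l * (h / l)) \<le> 8 * Q\<^sup>2 * (cmod h)\<^sup>2"
proof -
  have small: "Q * cmod (h / l) \<le> 1/2" if "1/4 < cmod l" for l
  proof -
    have "2 * (Q * cmod h) < 1/4" using h Q by (simp add: field_simps)
    then have "Q * cmod h \<le> 1/2 * cmod l" using that by linarith
    moreover have "cmod l > 0" using that by linarith
    ultimately show ?thesis by (simp add: norm_divide divide_le_eq)
  qed
  have termQ: "cmod (t n l * (h / l) ^ n) \<le> (Q * cmod (h / l)) ^ n" if "cmod l \<le> 1" for n l
    using mult_right_mono[OF bound[OF that, of n], of "cmod (h / l) ^ n"]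
    by (simp add: norm_mult norm_power power_mult_distrib)
  have term_le: "cmod (t n l * (h / l) ^ n) \<le> (1/2) ^ n" if "1/4 < cmod l" "cmod l \<le> 1" for n l
    by (rule order_trans[OF termQ[OF that(2)] power_mono[OF small[OF that(1)]]]) (use Q in simp)
  have summ: "summable (\<lambda>n. (1/2) ^ n :: real)" by (simp add: summable_geometric)
  have ul: "uniform_limit {l. 1/4 < cmod l \<and> cmod l \<le> 1} (\<lambda>N l. \<Sum>n<N. t n l * (h / l) ^ n) S sequentially"
    unfolding S_def by (rule Weierstrass_m_test[OF _ summ]) (use term_le in auto)
  have ann: "{l::complex. 1/4 < cmod l \<and> cmod l < 1} = ball 0 1 - cball 0 (1/4)" by auto
  have tc: "continuous_on {l. 1/4 < cmod l \<and> cmod l \<le> 1} (t n)"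
    and th: "t n holomorphic_on {l. 1/4 < cmod l \<and> cmod l < 1}" for n
    using t[of n] by (auto simp: disc_algebra_def elim!: continuous_on_subset holomorphic_on_subset)
  show ?th1
  proof (rule uniform_limit_theorem[OF _ ul])
    show "\<forall>\<^sub>F N in sequentially. continuous_on {l. 1/4 < cmod l \<and> cmod l \<le> 1} (\<lambda>l. \<Sum>n<N. t n l * (h / l) ^ n)"
      by (intro always_eventually allI continuous_intros tc) auto
  qed auto
  show ?th2
  proof (rule holomorphic_uniform_sequence)
    show "open {l::complex. 1/4 < cmod l \<and> cmod l < 1}"
      by (simp only: ann open_Diff open_ball closed_cball)
    show "(\<lambda>l. \<Sum>n<N. t n l * (h / l) ^ n) holomorphic_on {l. 1/4 < cmod l \<and> cmod l < 1}" for N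
      by (intro holomorphic_intros th) auto
    fix l :: complex assume l: "l \<in> {l. 1/4 < cmod l \<and> cmod l < 1}"
    then obtain d where d: "d > 0" "cball l d \<subseteq> {l. 1/4 < cmod l \<and> cmod l < 1}"
      using \<open>open {l::complex. 1/4 < cmod l \<and> cmod l < 1}\<close> open_contains_cball by blast
    have "uniform_limit (cball l d) (\<lambda>N l. \<Sum>n<N. t n l * (h / l) ^ n) S sequentially"
      by (rule uniform_limit_on_subset[OF ul]) (use d in auto)
    with d show "\<exists>d>0. cball l d \<subseteq> {l. 1/4 < cmod l \<and> cmod l < 1} \<and>
        uniform_limit (cball l d) (\<lambda>N l. \<Sum>n<N. t n l * (h / l) ^ n) S sequentially" by blast
  qed
  show sums: "(\<lambda>n. t n l * (h / l) ^ n) sums S l" if "1/4 < cmod l" "cmod l \<le> 1" for l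
    unfolding S_def by (intro summable_sums summable_comparison_test'[OF summ, of 0] term_le that)
  have geo: "(\<Sum>n. (1/2) ^ n :: real) = 2" by (simp add: suminf_geometric)
  show "cmod (S l) \<le> 2" if "1/4 < cmod l" "cmod l \<le> 1" for l
    using norm_suminf_le[OF term_le[OF that] summ] unfolding S_def geo .
  fix l :: complex assume l: "cmod l = 1/2"
  then have l': "1/4 < cmod l" "cmod l \<le> 1" by auto
  define q where "q = Q * cmod (h / l)"
  have "(\<lambda>n. t (n + 2) l * (h / l) ^ (n + 2)) sums (S l - (\<Sum>n<2. t n l * (h / l) ^ n))"
    by (rule sums_split_initial_segment[OF sums[OF l']])
  then have eq: "S l - t 0 l - t 1 l * (h / l) = (\<Sum>n. t (n + 2) l * (h / l) ^ (n + 2))"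
    by (simp add: sums_iff numeral_2_eq_2 algebra_simps)
  have "cmod (\<Sum>n. t (n + 2) l * (h / l) ^ (n + 2)) \<le> (\<Sum>n. q\<^sup>2 * (1/2) ^ n)"
  proof (rule norm_suminf_le)
    fix n
    have "cmod (t (n + 2) l * (h / l) ^ (n + 2)) \<le> q ^ (n + 2)" unfolding q_def by (rule termQ[OF l'(2)])
    also have "\<dots> = q\<^sup>2 * q ^ n" by (simp add: power2_eq_square)
    also have "\<dots> \<le> q\<^sup>2 * (1/2) ^ n"
      using small[OF l'(1)] Q by (intro mult_left_mono power_mono) (auto simp: q_def)
    finally show "cmod (t (n + 2) l * (h / l) ^ (n + 2)) \<le> q\<^sup>2 * (1/2) ^ n" .
  qed (intro summable_mult summ)
  also have "\<dots> = 2 * q\<^sup>2" unfolding suminf_mult[OF summ] geo by simp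
  also have "\<dots> = 8 * Q\<^sup>2 * (cmod h)\<^sup>2" by (simp add: q_def norm_divide l power_mult_distrib power_divide)
  finally show "cmod (S l - t 0 l - t 1 l * (h / l)) \<le> 8 * Q\<^sup>2 * (cmod h)\<^sup>2" unfolding eq .
qed

text \<open>The transition matrix \<open>C (z + h) = C z P\<close> extends holomorphically in \<open>l\<close> to an annulus inside the unit
  circle, with a first order expansion in \<open>h\<close> that is valid away from the circle as well.\<close>

lemma transition_matrix:
  fixes \<xi> :: "int \<Rightarrow> complex \<Rightarrow> complex^2^2" and C :: "complex \<Rightarrow> complex \<Rightarrow> complex^2^2"
  assumes D: "open D" "z \<in> D" and pot: "holomorphic_potential D \<xi>" and sol: "solves_potential D \<xi> C"
  obtains \<delta> K P \<eta> where "\<delta> > 0" "\<And>i k. disc_algebra (\<eta> i k)" "\<And>i k. \<eta> i k 0 = \<xi> (-1) z $ i $ k"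
    "\<And>h i k. cmod h < \<delta> \<Longrightarrow> continuous_on {l. 1/4 < cmod l \<and> cmod l \<le> 1} (P h i k)"
    "\<And>h i k. cmod h < \<delta> \<Longrightarrow> P h i k holomorphic_on {l. 1/4 < cmod l \<and> cmod l < 1}"
    "\<And>h j k l. cmod h < \<delta> \<Longrightarrow> cmod l = 1 \<Longrightarrow>
       C (z + h) l $ j $ k = (\<Sum>i\<in>UNIV. C z l $ j $ i * P h i k l)"
    "\<And>h i k l. cmod h < \<delta> \<Longrightarrow> cmod l = 1 \<Longrightarrow> cmod (P h i k l) \<le> 2"
    "\<And>h i k l. cmod h < \<delta> \<Longrightarrow> cmod l = 1/2 \<Longrightarrow>
       cmod (P h i k l - (if i = k then 1 else 0) - h * \<eta> i k l / l) \<le> K * (cmod h)\<^sup>2"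
proof -
  obtain r where r: "r > 0" "cball z r \<subseteq> D" using D open_contains_cball by blast
  have "uniformly_convergent_on (cball z r \<times> sphere 0 1) (\<lambda>n (z, l). potential_partial \<xi> n z l)"
    using pot r by (auto simp: holomorphic_potential_def)
  then obtain L where L: "uniform_limit (cball z r \<times> sphere 0 1)
      (\<lambda>n (w, l). potential_partial \<xi> n w l) L sequentially"
    by (auto simp: uniformly_convergent_on_def)
  define X where "X i k = (\<lambda>(w, l). l * L (w, l) $ i $ k)" for i k
  have X: "uniform_limit (cball z r \<times> sphere 0 1)
      (\<lambda>n (w, l). \<Sum>m<n. \<xi> (int m - 1) w $ i $ k * l ^ m) (X i k) sequentially" for i k
    unfolding X_def by (rule potential_uniform_limit[OF L])
  have pot_eq: "potential \<xi> w l $ i $ k = X i k (w, l) / l" if "w \<in> cball z r" "cmod l = 1" for w l i k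
  proof -
    have "(\<lambda>n. potential_partial \<xi> n w l) \<longlonglongrightarrow> L (w, l)"
      using tendsto_uniform_limitI[OF L, of "(w, l)"] that by simp
    then have "potential \<xi> w l = L (w, l)" by (simp add: potential_def limI)
    then show ?thesis using that by (auto simp: X_def)
  qed
  have hol: "(\<lambda>w. \<xi> (int m - 1) w $ i $ k) holomorphic_on cball z r" for m i k
  proof (rule holomorphic_on_subset[OF _ r(2)])
    have "-1 \<le> int m - 1" by simp
    then show "(\<lambda>w. \<xi> (int m - 1) w $ i $ k) holomorphic_on D"
      using pot unfolding holomorphic_potential_def by blast
  qed
  have "\<exists>e M. (\<forall>m. disc_algebra (e m)) \<and> (\<forall>m l. cmod l \<le> 1 \<longrightarrow> cmod (e m l) \<le> M / r ^ m)
      \<and> e 0 0 = \<xi> (-1) z $ i $ k \<and> (\<forall>l. cmod l = 1 \<longrightarrow> (\<lambda>w. X i k (w, l)) holomorphic_on ball z r)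
      \<and> (\<forall>m l. cmod l = 1 \<longrightarrow> e m l = (deriv ^^ m) (\<lambda>w. X i k (w, l)) z / fact m)" for i k
    by (rule taylor_coefficients_disc_algebra[OF hol r(1) X, of i k]) (auto intro!: exI)
  then obtain e M where e: "\<And>i k m. disc_algebra (e i k m)"
      "\<And>i k m l. cmod l \<le> 1 \<Longrightarrow> cmod (e i k m l) \<le> M i k / r ^ m"
      "\<And>i k. e i k 0 0 = \<xi> (-1) z $ i $ k"
      "\<And>i k l. cmod l = 1 \<Longrightarrow> (\<lambda>w. X i k (w, l)) holomorphic_on ball z r"
      "\<And>i k m l. cmod l = 1 \<Longrightarrow> e i k m l = (deriv ^^ m) (\<lambda>w. X i k (w, l)) z / fact m"
    by metis
  define \<eta> where "\<eta> m i k = e i k m" for m i k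
  define N where "N = (\<Sum>i\<in>UNIV. \<Sum>k\<in>UNIV. \<bar>M i k\<bar>)"
  have MN: "M i k \<le> N" for i k
  proof -
    have "M i k \<le> (\<Sum>k\<in>UNIV. \<bar>M i k\<bar>)" using member_le_sum[of k UNIV "\<lambda>k. \<bar>M i k\<bar>"] by simp
    also have "\<dots> \<le> N" unfolding N_def
      using member_le_sum[of i UNIV "\<lambda>i. \<Sum>k\<in>UNIV. \<bar>M i k\<bar>"] by (simp add: sum_nonneg)
    finally show ?thesis .
  qed
  have \<eta>_le: "cmod (\<eta> m i k l) \<le> N / r ^ m" if "cmod l \<le> 1" for m i k l
    unfolding \<eta>_def by (rule order_trans[OF e(2)[OF that]]) (use MN r in \<open>auto intro!: divide_right_mono\<close>)
  define Q where "Q = max (2 * N) (1 / r)"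
  have Q: "2 * N \<le> Q" "1 / r \<le> Q" "Q > 0" using r by (auto simp: Q_def less_max_iff_disj)
  define t where "t n i k = transition_coeff \<eta> n i k" for n i k
  have t: "disc_algebra (t n i k)" for n i k
    unfolding t_def by (rule transition_coeff_disc_algebra) (simp add: \<eta>_def e)
  have t_le: "cmod (t n i k l) \<le> Q ^ n" if "cmod l \<le> 1" for n i k l
    unfolding t_def by (rule transition_coeff_bound[where M=N and r=r]) (use \<eta>_le Q r that in auto)
  have t1: "t 1 i k l = \<eta> 0 i k l" for i k l
    by (simp add: t_def if_distrib[of "\<lambda>x. x * _"] cong: if_cong)
  define P where "P h i k l = (\<Sum>n. t n i k l * (h / l) ^ n)" for h i k l
  define \<delta> where "\<delta> = min r (1 / (8 * Q))"
  have \<delta>: "\<delta> > 0" using r Q by (simp add: \<delta>_def)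
  note P = power_series_loop[where t="\<lambda>n. t n i k" and Q=Q for i k, OF t t_le Q(3), folded P_def]
  have P1: "C (z + h) l $ j $ k = (\<Sum>i\<in>UNIV. C z l $ j $ i * P h i k l)"
    if h: "cmod h < \<delta>" and l: "cmod l = 1" for h j k l
  proof -
    have ode: "((\<lambda>w. C w l $ j $ k) has_field_derivative
        (\<Sum>i\<in>UNIV. C w l $ j $ i * X i k (w, l)) / l) (at w)" if "w \<in> ball z r" for w j k
    proof -
      have "(C w l ** potential \<xi> w l) $ j $ k = (\<Sum>i\<in>UNIV. C w l $ j $ i * X i k (w, l)) / l"
        using that l by (simp add: matrix_matrix_mult_def pot_eq sum_divide_distrib)
      moreover have "w \<in> D" "l \<in> sphere 0 1" using that r l by auto
      then have "((\<lambda>w. C w l $ j $ k) has_field_derivative (C w l ** potential \<xi> w l) $ j $ k) (at w)"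
        using sol unfolding solves_potential_def by blast
      ultimately show ?thesis by simp
    qed
    have coeff: "l ^ n * ((deriv ^^ n) (\<lambda>w. C w l $ j $ k) z / fact n) = (\<Sum>i\<in>UNIV. C z l $ j $ i * t n i k l)" for n
      unfolding t_def
      by (rule taylor_coeff_linear_ode[where X="\<lambda>i k w. X i k (w, l)" and C="\<lambda>j k w. C w l $ j $ k" and r=r])
         (use r l e ode in \<open>auto simp: \<eta>_def\<close>)
    have hol: "(\<lambda>w. C w l $ j $ k) holomorphic_on ball z r"
      unfolding holomorphic_on_open[OF open_ball] using ode by blast
    have "(\<lambda>n. (deriv ^^ n) (\<lambda>w. C w l $ j $ k) z / fact n * (z + h - z) ^ n) sums (C (z + h) l $ j $ k)"
      by (rule holomorphic_power_series[OF hol]) (use h in \<open>auto simp: \<delta>_def dist_norm\<close>)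
    moreover have "(deriv ^^ n) (\<lambda>w. C w l $ j $ k) z / fact n * (z + h - z) ^ n
       = (\<Sum>i\<in>UNIV. C z l $ j $ i * (t n i k l * (h / l) ^ n))" for n
    proof -
      have "(deriv ^^ n) (\<lambda>w. C w l $ j $ k) z / fact n * (z + h - z) ^ n
          = l ^ n * ((deriv ^^ n) (\<lambda>w. C w l $ j $ k) z / fact n) * (h / l) ^ n"
        using l by (auto simp: power_divide)
      then show ?thesis unfolding coeff sum_distrib_right by (simp add: mult.assoc)
    qed
    moreover have "(\<lambda>n. \<Sum>i\<in>UNIV. C z l $ j $ i * (t n i k l * (h / l) ^ n)) sums (\<Sum>i\<in>UNIV. C z l $ j $ i * P h i k l)"
      using h l by (intro sums_sum sums_mult P) (auto simp: \<delta>_def)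
    ultimately show ?thesis by (simp add: sums_iff)
  qed
  have P2: "cmod (P h i k l - (if i = k then 1 else 0) - h * \<eta> 0 i k l / l) \<le> 8 * Q\<^sup>2 * (cmod h)\<^sup>2"
    if "cmod h < \<delta>" "cmod l = 1/2" for h i k l
    using P(5)[of h l i k] that unfolding t1 by (simp add: \<delta>_def t_def mult.commute)
  show ?thesis
    by (rule that[of \<delta> "\<eta> 0" P "8 * Q\<^sup>2"])
       (use \<delta> e P1 P2 P(1,2,4) in \<open>auto simp: \<eta>_def \<delta>_def\<close>)
qed

section \<open>Unitary and positive loops\<close>

lemma SU2_entries:
  fixes A :: "complex^2^2"
  assumes "A \<in> SU2"
  shows "A $ 2 $ 2 = cnj (A $ 1 $ 1)" "A $ 1 $ 2 = - cnj (A $ 2 $ 1)"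
    "A $ 1 $ 1 * cnj (A $ 1 $ 1) + A $ 2 $ 1 * cnj (A $ 2 $ 1) = 1"
    "cmod (A $ j $ k) \<le> 1"
proof -
  define a b c d where "a = A $ 1 $ 1" and "b = A $ 1 $ 2" and "c = A $ 2 $ 1" and "d = A $ 2 $ 2"
  have eqs: "a * cnj a + b * cnj b = 1" "a * cnj c + b * cnj d = 0" "a * d - b * c = 1"
    using assms by (auto simp: SU2_def a_def b_def c_def d_def matrix_matrix_mult_def mat_def
        vec_eq_iff forall_2 sum_2 det_2)
  have "cnj (a * cnj c + b * cnj d) = 0" using eqs(2) by simp
  then have e2: "cnj a * c + cnj b * d = 0" by (simp add: mult.commute)
  have d: "d = cnj a" using eqs(1,3) e2 by algebra
  have "cnj b = - c" using eqs(1,3) e2 by algebra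
  then have b: "b = - cnj c" by (metis complex_cnj_cnj complex_cnj_minus)
  have n: "a * cnj a + c * cnj c = 1" using eqs(1) unfolding b by (simp add: mult.commute)
  show "A $ 2 $ 2 = cnj (A $ 1 $ 1)" "A $ 1 $ 2 = - cnj (A $ 2 $ 1)"
    "A $ 1 $ 1 * cnj (A $ 1 $ 1) + A $ 2 $ 1 * cnj (A $ 2 $ 1) = 1"
    using d b n by (simp_all add: a_def b_def c_def d_def)
  have "of_real ((cmod a)\<^sup>2 + (cmod c)\<^sup>2) = (1 :: complex)" 
    unfolding of_real_add complex_norm_square by (fact n)
  then have "(cmod a)\<^sup>2 + (cmod c)\<^sup>2 = 1" using of_real_eq_1_iff by blast
  then have "(cmod a)\<^sup>2 \<le> 1\<^sup>2" "(cmod c)\<^sup>2 \<le> 1\<^sup>2"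
    using zero_le_power2[of "cmod a"] zero_le_power2[of "cmod c"] by (simp_all, linarith+)
  then have "cmod a \<le> 1" "cmod c \<le> 1" by (auto simp: abs_square_le_1)
  moreover have "cmod d \<le> 1" "cmod b \<le> 1" unfolding d b using calculation by auto
  ultimately have "\<forall>j k. cmod (A $ j $ k) \<le> 1" by (simp add: forall_2 a_def b_def c_def d_def)
  then show "cmod (A $ j $ k) \<le> 1" by blast
qed

lemma SU2_mult_adjoint:
  fixes A :: "complex^2^2"
  assumes "A \<in> SU2"
  shows "(\<chi> j k. cnj (A $ k $ j)) ** A = mat 1"
  using SU2_entries(1-3)[OF assms]
  by (simp add: matrix_matrix_mult_def mat_def vec_eq_iff forall_2 sum_2 mult.commute add.commute)

text \<open>Determinant and parity are transported from the circle into the disc by the maximum principle; the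
  parity makes the value at \<open>0\<close> diagonal.\<close>

lemma Loop_SL2_plus_extension:
  fixes \<gamma> :: "complex \<Rightarrow> complex^2^2"
  assumes "\<gamma> \<in> Loop_SL2_plus"
  obtains H :: "2 \<Rightarrow> 2 \<Rightarrow> complex \<Rightarrow> complex" where "\<And>j k. disc_algebra (H j k)"
    "\<And>j k l. cmod l = 1 \<Longrightarrow> H j k l = \<gamma> l $ j $ k"
    "\<And>l. cmod l \<le> 1 \<Longrightarrow> H 1 1 l * H 2 2 l - H 1 2 l * H 2 1 l = 1"
    "H 1 2 0 = 0" "H 2 1 0 = 0"
proof -
  obtain N :: "complex \<Rightarrow> complex^2^2" where N: "continuous_on (cball 0 1) N" "\<And>j k. (\<lambda>l. N l $ j $ k) holomorphic_on ball 0 1"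
    "\<And>l. cmod l = 1 \<Longrightarrow> N l = \<gamma> l" and \<gamma>: "\<gamma> \<in> Loop_SL2"
    using assms by (auto simp: Loop_SL2_plus_def)
  define H where "H j k l = N l $ j $ k" for j k l
  have H: "disc_algebra (H j k)" for j k
    unfolding disc_algebra_def H_def[abs_def] using N by (auto intro!: continuous_intros)
  have bd: "H j k l = \<gamma> l $ j $ k" if "cmod l = 1" for j k l using N that by (simp add: H_def)
  have det: "H 1 1 l * H 2 2 l - H 1 2 l * H 2 1 l = 1" if "cmod l \<le> 1" for l
    by (rule disc_algebra_eq[OF _ disc_algebra_const, where u="\<lambda>l. H 1 1 l * H 2 2 l - H 1 2 l * H 2 1 l"])
       (use H \<gamma> that in \<open>auto intro!: disc_algebra_intros simp: bd Loop_SL2_def det_2\<close>)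
  have odd: "H j k 0 = 0" if "j \<noteq> k" for j k
  proof -
    have "disc_algebra (\<lambda>l. H j k (- l))" by (rule disc_algebra_reflect[OF H])
    then have "disc_algebra (\<lambda>l. H j k l + H j k (- l))" by (rule disc_algebra_add[OF H])
    moreover have "H j k l + H j k (- l) = 0" if "cmod l = 1" for l
    proof -
      have "l \<in> sphere 0 1" using that by simp
      then have "\<gamma> (- l) $ j $ k = - (\<gamma> l $ j $ k)"
        using \<gamma> \<open>j \<noteq> k\<close> unfolding Loop_SL2_def twisted_def by simp
      then show ?thesis using that by (simp add: bd)
    qed
    ultimately have "H j k 0 + H j k (- 0) = 0"
      by (rule disc_algebra_eq[OF _ disc_algebra_const]) auto
    then show ?thesis by simp
  qed
  show ?thesis using that[of H] H bd det odd by auto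
qed

lemma triple_product_bound:
  fixes x y :: "2 \<Rightarrow> complex" and e :: "2 \<Rightarrow> 2 \<Rightarrow> complex"
  assumes "\<And>i. cmod (x i) \<le> X" "\<And>i m. cmod (e i m) \<le> E" "\<And>m. cmod (y m) \<le> Y"
  shows "cmod (\<Sum>i\<in>UNIV. \<Sum>m\<in>UNIV. x i * e i m * y m) \<le> 4 * (X * E * Y)"
proof -
  have nn: "X \<ge> 0" "E \<ge> 0" "Y \<ge> 0" using assms norm_ge_zero order_trans by blast+
  have "cmod (\<Sum>m\<in>UNIV. x i * e i m * y m) \<le> of_nat (card (UNIV :: 2 set)) * (X * E * Y)" for i
    by (rule sum_norm_bound) (unfold norm_mult, intro mult_mono mult_nonneg_nonneg assms nn norm_ge_zero)
  then have "cmod (\<Sum>i\<in>UNIV. \<Sum>m\<in>UNIV. x i * e i m * y m)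
      \<le> of_nat (card (UNIV :: 2 set)) * (of_nat (card (UNIV :: 2 set)) * (X * E * Y))"
    by (rule sum_norm_bound)
  then show ?thesis by simp
qed

section \<open>Second order expansion of the unitary frame\<close>

lemma norm_diff_cnj_le: "cmod (x - y - cnj w) \<le> cmod x + cmod y + cmod w"
  using norm_triangle_ineq4[of "x - y" "cnj w"] norm_triangle_ineq4[of x y] by simp

text \<open>For a unitary loop close to \<open>U + V / s\<close> on the circle \<open>|s| = 1/2\<close>, the reality formula yields its value at
  \<open>1\<close>: the diagonal is given by the constant term of \<open>U\<close>, and the entry below it by the negative parts
  \<open>V 2 1 0 / s\<close> and \<open>V 1 2 0 / s\<close>. For the latter entry the constant term has to drop out exactly, since it
  is known only up to the larger error; oddness in \<open>l\<close> removes it.\<close>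

lemma SU2_loop_estimate:
  fixes G U V :: "2 \<Rightarrow> 2 \<Rightarrow> complex \<Rightarrow> complex"
  assumes cont: "\<And>j k. continuous_on {l. 1/4 < cmod l \<and> cmod l \<le> 1} (G j k)"
    and hol: "\<And>j k. G j k holomorphic_on {l. 1/4 < cmod l \<and> cmod l < 1}"
    and SU2: "\<And>l. cmod l = 1 \<Longrightarrow> G 2 2 l = cnj (G 1 1 l)" "\<And>l. cmod l = 1 \<Longrightarrow> G 1 2 l = - cnj (G 2 1 l)"
    and odd: "G 2 1 (- 1) = - G 2 1 1"
    and U: "\<And>j k. disc_algebra (U j k)" and V: "\<And>j k. disc_algebra (V j k)"
    and err1: "\<And>j k s. cmod s = 1/2 \<Longrightarrow> cmod (G j k s - U j k s) \<le> err1"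
    and err2: "\<And>j k s. cmod s = 1/2 \<Longrightarrow> cmod (G j k s - U j k s - V j k s / s) \<le> err2"
  shows "cmod (G 1 1 1 - U 1 1 0) \<le> 3 * err1" "cmod (cnj (G 1 1 1) - U 2 2 0) \<le> 3 * err1"
    "cmod (G 2 1 1 - (V 2 1 0 - cnj (V 1 2 0))) \<le> 2 * err2"
proof -
  have circ: "continuous_on (sphere 0 (1/2)) (G j k)" for j k
    by (rule continuous_on_subset[OF cont]) auto
  have center: "cmod (cauchy (G j k) 0 - U j k 0) \<le> err1" for j k
    by (rule cauchy_estimate_center[OF circ U err1])
  have outer1: "cmod (cauchy (G j k) 1) \<le> err1" for j k
    using cauchy_estimate_outside[OF circ U disc_algebra_const[of 0], of j k j k err1 1] err1 by simp
  have "G 1 1 1 = cauchy (G 1 1) 0 - cauchy (G 1 1) 1 - cnj (cauchy (G 2 2) 1)"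
    by (rule reality_formula[OF cont hol cont hol]) (auto simp: SU2)
  then have "G 1 1 1 - U 1 1 0 = (cauchy (G 1 1) 0 - U 1 1 0) - cauchy (G 1 1) 1 - cnj (cauchy (G 2 2) 1)"
    by simp
  also have "cmod \<dots> \<le> cmod (cauchy (G 1 1) 0 - U 1 1 0) + cmod (cauchy (G 1 1) 1) + cmod (cauchy (G 2 2) 1)"
    by (rule norm_diff_cnj_le)
  also have "\<dots> \<le> 3 * err1" using center[of 1 1] outer1[of 1 1] outer1[of 2 2] by linarith
  finally show "cmod (G 1 1 1 - U 1 1 0) \<le> 3 * err1" .
  have "G 2 2 1 = cauchy (G 2 2) 0 - cauchy (G 2 2) 1 - cnj (cauchy (G 1 1) 1)"
    by (rule reality_formula[OF cont hol cont hol]) (auto simp: SU2)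
  then have "cnj (G 1 1 1) - U 2 2 0 = (cauchy (G 2 2) 0 - U 2 2 0) - cauchy (G 2 2) 1 - cnj (cauchy (G 1 1) 1)"
    by (simp add: SU2)
  also have "cmod \<dots> \<le> cmod (cauchy (G 2 2) 0 - U 2 2 0) + cmod (cauchy (G 2 2) 1) + cmod (cauchy (G 1 1) 1)"
    by (rule norm_diff_cnj_le)
  also have "\<dots> \<le> 3 * err1" using center[of 2 2] outer1[of 1 1] outer1[of 2 2] by linarith
  finally show "cmod (cnj (G 1 1 1) - U 2 2 0) \<le> 3 * err1" .
  define q where "q = (\<lambda>l. - G 1 2 l)"
  have q: "continuous_on {l. 1/4 < cmod l \<and> cmod l \<le> 1} q" "q holomorphic_on {l. 1/4 < cmod l \<and> cmod l < 1}"
    "continuous_on (sphere 0 (1/2)) q"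
    unfolding q_def by (intro continuous_intros holomorphic_intros cont hol circ)+
  have real: "G 2 1 l = cauchy (G 2 1) 0 - cauchy (G 2 1) l - cnj (cauchy q l)" if "cmod l = 1" for l
    by (rule reality_formula[OF cont hol q(1,2) _ that]) (simp add: q_def SU2)
  have p': "cmod (cauchy (G 2 1) l + V 2 1 0 / l) \<le> err2" if "cmod l = 1" for l
    by (rule cauchy_estimate_outside[OF circ U V err2 that])
  have q': "cmod (cauchy q l - V 1 2 0 / l) \<le> err2" if "cmod l = 1" for l
  proof -
    have "cmod (q s - (- U 1 2 s) - (- V 1 2 s) / s) \<le> err2" if "cmod s = 1/2" for s
      using err2[OF that, of 1 2] norm_minus_cancel[of "G 1 2 s - U 1 2 s - V 1 2 s / s"]
      by (simp add: q_def algebra_simps)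
    from cauchy_estimate_outside[OF q(3) disc_algebra_minus[OF U] disc_algebra_minus[OF V] this \<open>cmod l = 1\<close>]
    show ?thesis by simp
  qed
  have "2 * G 2 1 1 = G 2 1 1 - G 2 1 (- 1)" by (simp add: odd)
  also have "\<dots> = cauchy (G 2 1) (- 1) - cauchy (G 2 1) 1 + cnj (cauchy q (- 1)) - cnj (cauchy q 1)"
    by (simp add: real)
  finally have "2 * (G 2 1 1 - (V 2 1 0 - cnj (V 1 2 0)))
      = (cauchy (G 2 1) (- 1) + V 2 1 0 / (- 1)) - (cauchy (G 2 1) 1 + V 2 1 0 / 1)
        + cnj (cauchy q (- 1) - V 1 2 0 / (- 1)) - cnj (cauchy q 1 - V 1 2 0 / 1)"
    by (simp add: algebra_simps)
  also have "cmod \<dots> \<le> cmod (cauchy (G 2 1) (- 1) + V 2 1 0 / (- 1)) + cmod (cauchy (G 2 1) 1 + V 2 1 0 / 1)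
        + cmod (cnj (cauchy q (- 1) - V 1 2 0 / (- 1))) + cmod (cnj (cauchy q 1 - V 1 2 0 / 1))"
    by (intro norm_triangle_le_diff norm_triangle_le add_mono order_refl)
  also have "\<dots> \<le> 4 * err2"
    unfolding complex_mod_cnj using p'[of 1] p'[of "- 1"] q'[of 1] q'[of "- 1"] by simp
  finally show "cmod (G 2 1 1 - (V 2 1 0 - cnj (V 1 2 0))) \<le> 2 * err2"
    unfolding norm_mult by simp
qed

text \<open>Applied to \<open>G = H P W\<close>: the disc algebra part is \<open>H W\<close>, and \<open>h H \<eta> W / l\<close> is the first order term coming
  from the pole of the potential. The expressions in \<open>F\<close> are the entries \<open>G 1 1\<close> and \<open>G 2 1\<close> of the
  product of the adjoint of \<open>F z 1\<close> with \<open>F (z + h) 1\<close>, and \<open>H\<close> and \<open>W\<close> have the values \<open>diag(r, 1/r)\<close> and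
  \<open>diag(s, 1/s)\<close> at \<open>0\<close>. The number \<open>s\<close> depends on \<open>h\<close> in an unknown way, but it is bounded together with
  its inverse.\<close>

lemma frame_transition_estimate:
  fixes \<xi> :: "int \<Rightarrow> complex \<Rightarrow> complex^2^2" and C F Bp :: "complex \<Rightarrow> complex \<Rightarrow> complex^2^2"
  assumes D: "open D" and pot: "holomorphic_potential D \<xi>" and sol: "solves_potential D \<xi> C"
    and D': "open D'" "D' \<subseteq> D" "z \<in> D'" and iwa: "iwasawa_decomposition D' C F Bp"
  defines "a \<equiv> \<xi> (-1) z $ 1 $ 2" and "b \<equiv> \<xi> (-1) z $ 2 $ 1"
  obtains \<delta> K r where "\<delta> > 0" "r \<noteq> 0" "ball z \<delta> \<subseteq> D'"
    "\<And>h. cmod h < \<delta> \<Longrightarrow> \<exists>s. s \<noteq> 0 \<and> cmod s \<le> K \<and> cmod (1 / s) \<le> K \<and>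
       cmod (cnj (F z 1 $ 1 $ 1) * F (z + h) 1 $ 1 $ 1 + cnj (F z 1 $ 2 $ 1) * F (z + h) 1 $ 2 $ 1 - r * s) \<le> K * cmod h \<and>
       cmod (cnj (cnj (F z 1 $ 1 $ 1) * F (z + h) 1 $ 1 $ 1 + cnj (F z 1 $ 2 $ 1) * F (z + h) 1 $ 2 $ 1) - 1 / (r * s))
         \<le> K * cmod h \<and>
       cmod (F z 1 $ 1 $ 1 * F (z + h) 1 $ 2 $ 1 - F z 1 $ 2 $ 1 * F (z + h) 1 $ 1 $ 1
         - (h * (b * s / r) - cnj (h * (a * r / s)))) \<le> K * (cmod h)\<^sup>2"
proof -
  have zD: "z \<in> D" using D' by auto
  obtain \<delta> K P \<eta> where P: "\<delta> > 0" "\<And>i k. disc_algebra (\<eta> i k)" "\<And>i k. \<eta> i k 0 = \<xi> (-1) z $ i $ k"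
    "\<And>h i k. cmod h < \<delta> \<Longrightarrow> continuous_on {l. 1/4 < cmod l \<and> cmod l \<le> 1} (P h i k)"
    "\<And>h i k. cmod h < \<delta> \<Longrightarrow> P h i k holomorphic_on {l. 1/4 < cmod l \<and> cmod l < 1}"
    "\<And>h j k l. cmod h < \<delta> \<Longrightarrow> cmod l = 1 \<Longrightarrow>
       C (z + h) l $ j $ k = (\<Sum>i\<in>UNIV. C z l $ j $ i * P h i k l)"
    "\<And>h i k l. cmod h < \<delta> \<Longrightarrow> cmod l = 1 \<Longrightarrow> cmod (P h i k l) \<le> 2"
    "\<And>h i k l. cmod h < \<delta> \<Longrightarrow> cmod l = 1/2 \<Longrightarrow>
       cmod (P h i k l - (if i = k then 1 else 0) - h * \<eta> i k l / l) \<le> K * (cmod h)\<^sup>2"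
    by (rule transition_matrix[OF D zD pot sol]) blast
  have iw: "F w \<in> Loop_SU2" "Bp w \<in> Loop_SL2_plus" "\<And>l. cmod l = 1 \<Longrightarrow> C w l = F w l ** Bp w l"
    if "w \<in> D'" for w using iwa that by (auto simp: iwasawa_decomposition_def)
  have SU2F: "F w l \<in> SU2" if "w \<in> D'" "cmod l = 1" for w l
    using iw(1)[OF that(1)] that by (auto simp: Loop_SU2_def)
  obtain H where H: "\<And>j k. disc_algebra (H j k)" "\<And>j k l. cmod l = 1 \<Longrightarrow> H j k l = Bp z l $ j $ k"
    "\<And>l. cmod l \<le> 1 \<Longrightarrow> H 1 1 l * H 2 2 l - H 1 2 l * H 2 1 l = 1" "H 1 2 0 = 0" "H 2 1 0 = 0"
    by (rule Loop_SL2_plus_extension[OF iw(2)[OF D'(3)]]) blast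
  obtain M where M: "M \<ge> 0" "\<And>j k l. cmod l \<le> 1 \<Longrightarrow> cmod (H j k l) \<le> M"
    using disc_algebra_family_bound[of H] H(1) by metis
  obtain N where N: "N \<ge> 0" "\<And>j k l. cmod l \<le> 1 \<Longrightarrow> cmod (\<eta> j k l) \<le> N"
    using disc_algebra_family_bound[of \<eta>] P(2) by metis
  obtain d where d: "d > 0" "ball z d \<subseteq> D'" using D' open_contains_ball by blast
  have K0: "K \<ge> 0"
  proof -
    define h where "h = complex_of_real (\<delta> / 2)"
    have "cmod h < \<delta>" "cmod h > 0" using P(1) by (auto simp: h_def)
    moreover have "0 \<le> K * (cmod h)\<^sup>2"
      using order_trans[OF norm_ge_zero P(8)[of h "1/2" 1 1]] \<open>cmod h < \<delta>\<close> by simp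
    ultimately show ?thesis by (simp add: zero_le_mult_iff)
  qed
  have \<xi>_diag: "\<xi> (-1) z $ i $ i = 0" for i using pot zD by (auto simp: holomorphic_potential_def)
  define r where "r = H 1 1 0"
  have r: "r * H 2 2 0 = 1" using H(3)[of 0] H(4,5) by (simp add: r_def)
  define E2 where "E2 = 4 * (M * K * (16 * M))"
  define E1 where "E1 = E2 + 8 * (M * N * (16 * M))"
  have E: "E2 \<ge> 0" "E1 \<ge> 0" using M N K0 by (auto simp: E1_def E2_def)
  define L where "L = 16 * M + 3 * E1 + 2 * E2"
  show ?thesis
  proof (rule that[of "min 1 (min \<delta> d)" r L])
    show "min 1 (min \<delta> d) > 0" "r \<noteq> 0" "ball z (min 1 (min \<delta> d)) \<subseteq> D'" using P(1) d r by auto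
    fix h assume "cmod h < min 1 (min \<delta> d)"
    then have h: "cmod h < \<delta>" "cmod h < d" "cmod h < 1" by auto
    have zh: "z + h \<in> D'" using d h by (auto simp: dist_norm)
    obtain H' where H': "\<And>j k. disc_algebra (H' j k)" "\<And>j k l. cmod l = 1 \<Longrightarrow> H' j k l = Bp (z + h) l $ j $ k"
      "\<And>l. cmod l \<le> 1 \<Longrightarrow> H' 1 1 l * H' 2 2 l - H' 1 2 l * H' 2 1 l = 1" "H' 1 2 0 = 0" "H' 2 1 0 = 0"
      by (rule Loop_SL2_plus_extension[OF iw(2)[OF zh]]) blast
    \<comment> \<open>\<open>W\<close> is the adjugate of \<open>H'\<close>, hence its inverse.\<close>
    define W where "W j k l = (if j = k then H' (if j = 1 then 2 else 1) (if j = 1 then 2 else 1) l else - H' j k l)" for j k l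
    define adj where "adj l = (\<chi> j k. cnj (F (z + h) l $ k $ j))" for l
    define adz where "adz l = (\<chi> j k. cnj (F z l $ k $ j))" for l
    define Pm where "Pm l = (\<chi> j k. P h j k l)" for l
    define Wm where "Wm l = (\<chi> j k. W j k l)" for l
    have W: "disc_algebra (W j k)" for j k
      unfolding W_def[abs_def] using H'(1) by (cases "j = k") (auto intro: disc_algebra_minus)
    have CP: "C (z + h) l = C z l ** Pm l" if "cmod l = 1" for l
      using P(6)[OF h(1) that] by (simp add: vec_eq_iff matrix_matrix_mult_def Pm_def)
    \<comment> \<open>A bound independent of \<open>h\<close>: on the circle \<open>H'\<close> is the product of a unitary matrix with
      \<open>F z H P\<close>, and the maximum principle does the rest.\<close>
    have H'bound: "cmod (H' j k l) \<le> 16 * M" if "cmod l \<le> 1" for j k l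
    proof (rule disc_algebra_bound[OF H'(1) _ that])
      fix l :: complex assume l: "cmod l = 1"
      have "Bp (z + h) l = adj l ** (F (z + h) l ** Bp (z + h) l)"
        unfolding matrix_mul_assoc adj_def SU2_mult_adjoint[OF SU2F[OF zh l]] by simp
      also have "\<dots> = adj l ** ((F z l ** Bp z l) ** Pm l)"
        using CP[OF l] iw(3)[OF zh l] iw(3)[OF D'(3) l] by simp
      finally have "Bp (z + h) l $ j $ k = (\<Sum>i\<in>UNIV. \<Sum>m\<in>UNIV. adj l $ j $ i * (F z l ** Bp z l) $ i $ m * Pm l $ m $ k)"
        by (simp add: matrix_matrix_mult_def sum_2 algebra_simps)
      also have "cmod \<dots> \<le> 4 * (1 * (2 * (1 * M)) * 2)"
      proof (rule triple_product_bound)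
        show "cmod (adj l $ j $ i) \<le> 1" for i by (simp add: adj_def SU2_entries(4)[OF SU2F[OF zh l]])
        show "cmod (Pm l $ m $ k) \<le> 2" for m by (simp add: Pm_def P(7)[OF h(1) l])
        fix i m
        have "cmod (\<Sum>n\<in>UNIV. F z l $ i $ n * Bp z l $ n $ m) \<le> of_nat (card (UNIV :: 2 set)) * (1 * M)"
        proof (rule sum_norm_bound)
          show "cmod (F z l $ i $ n * Bp z l $ n $ m) \<le> 1 * M" for n
            unfolding norm_mult using M(2)[of l n m] l H(2)[OF l, of n m]
            by (intro mult_mono SU2_entries(4)[OF SU2F[OF D'(3) l]]) auto
        qed
        then show "cmod ((F z l ** Bp z l) $ i $ m) \<le> 2 * (1 * M)" by (simp add: matrix_matrix_mult_def)
      qed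
      finally show "cmod (H' j k l) \<le> 16 * M" using H'(2)[OF l] by simp
    qed
    have Wbound: "cmod (W j k l) \<le> 16 * M" if "cmod l \<le> 1" for j k l
      using H'bound[OF that] by (simp add: W_def)
    define G where "G j k l = (\<Sum>i\<in>UNIV. \<Sum>m\<in>UNIV. H j i l * P h i m l * W m k l)" for j k l
    have G: "G j k l = (adz l ** F (z + h) l) $ j $ k" if l: "cmod l = 1" for j k l
    proof -
      have inv: "Bp (z + h) l ** Wm l = mat 1"
        using H'(3)[of l] l
        by (simp add: matrix_matrix_mult_def mat_def vec_eq_iff forall_2 sum_2 Wm_def W_def H'(2)[OF l, symmetric])
           (simp add: mult.commute)
      have "F (z + h) l = F (z + h) l ** (Bp (z + h) l ** Wm l)" by (simp add: inv)
      also have "\<dots> = F z l ** (Bp z l ** Pm l ** Wm l)"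
        using CP[OF l] iw(3)[OF zh l] iw(3)[OF D'(3) l] by (simp add: matrix_mul_assoc)
      finally have "adz l ** F (z + h) l = (adz l ** F z l) ** (Bp z l ** Pm l ** Wm l)"
        by (simp add: matrix_mul_assoc)
      also have "\<dots> = Bp z l ** Pm l ** Wm l"
        unfolding adz_def SU2_mult_adjoint[OF SU2F[OF D'(3) l]] by simp
      finally show ?thesis
        by (simp add: matrix_matrix_mult_def G_def H(2)[OF l] Pm_def Wm_def sum_2 algebra_simps)
    qed
    have G_entries: "G 1 1 l = cnj (F z l $ 1 $ 1) * F (z + h) l $ 1 $ 1 + cnj (F z l $ 2 $ 1) * F (z + h) l $ 2 $ 1"
      "G 2 1 l = F z l $ 1 $ 1 * F (z + h) l $ 2 $ 1 - F z l $ 2 $ 1 * F (z + h) l $ 1 $ 1"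
      "G 2 2 l = cnj (G 1 1 l)" "G 1 2 l = - cnj (G 2 1 l)" if l: "cmod l = 1" for l
      unfolding G[OF l] using SU2_entries(1,2)[OF SU2F[OF zh l]] SU2_entries(1,2)[OF SU2F[OF D'(3) l]]
      by (simp_all add: matrix_matrix_mult_def adz_def sum_2 algebra_simps)
    have tw: "F w (- 1) $ j $ k = (if j = k then F w 1 $ j $ k else - (F w 1 $ j $ k))" if "w \<in> D'" for w j k
      using iw(1)[OF that] unfolding Loop_SU2_def twisted_def by simp
    have G_odd: "G 2 1 (- 1) = - G 2 1 1"
      by (simp add: G_entries tw[OF zh] tw[OF D'(3)])
    define U where "U j k l = (\<Sum>i\<in>UNIV. H j i l * W i k l)" for j k l
    define V where "V j k l = h * (\<Sum>i\<in>UNIV. \<Sum>m\<in>UNIV. H j i l * \<eta> i m l * W m k l)" for j k l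
    have HWc: "continuous_on {l. 1/4 < cmod l \<and> cmod l \<le> 1} (H j k)" "H j k holomorphic_on {l. 1/4 < cmod l \<and> cmod l < 1}"
      "continuous_on {l. 1/4 < cmod l \<and> cmod l \<le> 1} (W j k)" "W j k holomorphic_on {l. 1/4 < cmod l \<and> cmod l < 1}" for j k
      using H(1)[of j k] W[of j k]
      by (auto simp: disc_algebra_def elim!: continuous_on_subset holomorphic_on_subset)
    have err2: "cmod (G j k s - U j k s - V j k s / s) \<le> E2 * (cmod h)\<^sup>2" if s: "cmod s = 1/2" for j k s
    proof -
      have "G j k s - U j k s - V j k s / s
          = (\<Sum>i\<in>UNIV. \<Sum>m\<in>UNIV. H j i s * (P h i m s - (if i = m then 1 else 0) - h * \<eta> i m s / s) * W m k s)"
        by (simp add: G_def U_def V_def sum_2 algebra_simps add_divide_distrib)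
      also have "cmod \<dots> \<le> 4 * (M * (K * (cmod h)\<^sup>2) * (16 * M))"
        using s by (intro triple_product_bound M Wbound P(8) h(1)) auto
      finally show ?thesis by (simp add: E2_def mult_ac)
    qed
    have err1: "cmod (G j k s - U j k s) \<le> E1 * cmod h" if s: "cmod s = 1/2" for j k s
    proof -
      have "cmod (\<Sum>i\<in>UNIV. \<Sum>m\<in>UNIV. H j i s * \<eta> i m s * W m k s) \<le> 4 * (M * N * (16 * M))"
        using s by (intro triple_product_bound M Wbound N) auto
      then have "2 * cmod h * cmod (\<Sum>i\<in>UNIV. \<Sum>m\<in>UNIV. H j i s * \<eta> i m s * W m k s)
          \<le> 2 * cmod h * (4 * (M * N * (16 * M)))" by (intro mult_left_mono) auto
      moreover have "cmod (V j k s / s) = 2 * cmod h * cmod (\<Sum>i\<in>UNIV. \<Sum>m\<in>UNIV. H j i s * \<eta> i m s * W m k s)"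
        unfolding V_def norm_divide norm_mult s by simp
      ultimately have "cmod (V j k s / s) \<le> 8 * (M * N * (16 * M)) * cmod h"
        by (simp add: mult_ac)
      moreover have "E2 * (cmod h)\<^sup>2 \<le> E2 * cmod h"
        using h(3) E by (intro mult_left_mono) (auto simp: power2_eq_square mult_left_le)
      ultimately show ?thesis
        using err2[OF s, of j k] norm_triangle_ineq[of "G j k s - U j k s - V j k s / s" "V j k s / s"]
        by (simp add: E1_def algebra_simps)
    qed
    define s where "s = W 1 1 0"
    have s: "s * W 2 2 0 = 1" using H'(3)[of 0] H'(4,5) by (simp add: s_def W_def mult.commute)
    have W0: "W 1 2 0 = 0" "W 2 1 0 = 0" using H' by (simp_all add: W_def)
    have nz: "s \<noteq> 0" "r \<noteq> 0" using r s by auto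
    then have inv: "H 2 2 0 = 1 / r" "W 2 2 0 = 1 / s" "s \<noteq> 0" "r \<noteq> 0"
      using r s by (simp_all add: eq_divide_eq mult.commute)
    have U0: "U 1 1 0 = r * s" "U 2 2 0 = 1 / (r * s)"
      using H(4,5) W0 inv by (simp_all add: U_def sum_2 r_def s_def)
    have V0: "V 2 1 0 = h * (b * s / r)" "V 1 2 0 = h * (a * r / s)"
      using H(4,5) W0 inv by (simp_all add: V_def sum_2 P(3) a_def b_def r_def s_def)
    have est: "cmod (G 1 1 1 - U 1 1 0) \<le> 3 * (E1 * cmod h)" "cmod (cnj (G 1 1 1) - U 2 2 0) \<le> 3 * (E1 * cmod h)"
      "cmod (G 2 1 1 - (V 2 1 0 - cnj (V 1 2 0))) \<le> 2 * (E2 * (cmod h)\<^sup>2)"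
    proof -
      have c: "continuous_on {l. 1/4 < cmod l \<and> cmod l \<le> 1} (G j k)"
        and ho: "G j k holomorphic_on {l. 1/4 < cmod l \<and> cmod l < 1}"
        and du: "disc_algebra (U j k)" and dv: "disc_algebra (V j k)" for j k
        unfolding G_def[abs_def] U_def[abs_def] V_def[abs_def]
        by (intro continuous_intros holomorphic_intros disc_algebra_intros HWc P(2,4,5) h(1) H(1) W)+
      note * = SU2_loop_estimate[OF c ho G_entries(3,4) G_odd du dv err1 err2]
      show "cmod (G 1 1 1 - U 1 1 0) \<le> 3 * (E1 * cmod h)" "cmod (cnj (G 1 1 1) - U 2 2 0) \<le> 3 * (E1 * cmod h)"
        "cmod (G 2 1 1 - (V 2 1 0 - cnj (V 1 2 0))) \<le> 2 * (E2 * (cmod h)\<^sup>2)"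
        by (rule *; assumption)+
    qed
    have L: "3 * (E1 * cmod h) \<le> L * cmod h" "2 * (E2 * (cmod h)\<^sup>2) \<le> L * (cmod h)\<^sup>2" "16 * M \<le> L"
      using E M unfolding L_def by (auto simp: algebra_simps)
    have "cmod s \<le> L" "cmod (1 / s) \<le> L"
      using Wbound[of 0 1 1] Wbound[of 0 2 2] inv L(3) unfolding s_def by (auto intro: order_trans)
    then show "\<exists>s. s \<noteq> 0 \<and> cmod s \<le> L \<and> cmod (1 / s) \<le> L \<and>
       cmod (cnj (F z 1 $ 1 $ 1) * F (z + h) 1 $ 1 $ 1 + cnj (F z 1 $ 2 $ 1) * F (z + h) 1 $ 2 $ 1 - r * s) \<le> L * cmod h \<and>
       cmod (cnj (cnj (F z 1 $ 1 $ 1) * F (z + h) 1 $ 1 $ 1 + cnj (F z 1 $ 2 $ 1) * F (z + h) 1 $ 2 $ 1) - 1 / (r * s))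
         \<le> L * cmod h \<and>
       cmod (F z 1 $ 1 $ 1 * F (z + h) 1 $ 2 $ 1 - F z 1 $ 2 $ 1 * F (z + h) 1 $ 1 $ 1
         - (h * (b * s / r) - cnj (h * (a * r / s)))) \<le> L * (cmod h)\<^sup>2"
      using inv(3) est(1)[unfolded U0, THEN order_trans, OF L(1)] est(2)[unfolded U0, THEN order_trans, OF L(1)]
        est(3)[unfolded V0, THEN order_trans, OF L(2)]
      by (intro exI[of _ s]) (simp add: G_entries)
  qed
qed

lemma has_derivative_quadratic_error:
  fixes T :: "complex \<Rightarrow> complex"
  assumes "bounded_linear L" and d: "d > 0" and T0: "T z = 0"
    and le: "\<And>h. cmod h < d \<Longrightarrow> cmod (T (z + h) - L h) \<le> K * (cmod h)\<^sup>2"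
  shows "(T has_derivative L) (at z)"
proof (rule has_derivativeI_sandwich[OF d assms(1)])
  show "norm (T y - T z - L (y - z)) / norm (y - z) \<le> K * cmod (y - z)"
    if "y \<noteq> z" "dist y z < d" for y
    using le[of "y - z"] that T0 by (simp add: dist_norm divide_le_eq power2_eq_square mult.assoc)
  show "((\<lambda>y. K * cmod (y - z)) \<longlongrightarrow> 0) (at z within UNIV)" by (auto intro!: tendsto_eq_intros)
qed

text \<open>Both diagonal estimates are needed to eliminate \<open>s\<close> from \<open>G 2 1 / G 1 1\<close>: the first one turns \<open>r s\<close>
  into \<open>G 1 1\<close>, the second one turns \<open>1 / (r s)\<close> into \<open>cnj (G 1 1)\<close>.\<close>

lemma frame_motion:
  fixes \<xi> :: "int \<Rightarrow> complex \<Rightarrow> complex^2^2" and C F Bp :: "complex \<Rightarrow> complex \<Rightarrow> complex^2^2"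
  assumes D: "open D" and pot: "holomorphic_potential D \<xi>" and sol: "solves_potential D \<xi> C"
    and D': "open D'" "D' \<subseteq> D" "z \<in> D'" and iwa: "iwasawa_decomposition D' C F Bp"
  defines "p \<equiv> F z 1 $ 1 $ 1" and "q \<equiv> F z 1 $ 2 $ 1"
  obtains T \<alpha> \<beta> d where "\<alpha> * \<beta> = \<xi> (-1) z $ 1 $ 2 * \<xi> (-1) z $ 2 $ 1" "T z = 0"
    "(T has_derivative (\<lambda>h. \<beta> * h - cnj (\<alpha> * h))) (at z)" "d > 0"
    "\<And>w. dist z w < d \<Longrightarrow> \<exists>g. g \<noteq> 0 \<and> F w 1 $ 1 $ 1 = g * (p - cnj q * T w) \<and> F w 1 $ 2 $ 1 = g * (q + cnj p * T w)"
proof -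
  define a b where "a = \<xi> (-1) z $ 1 $ 2" and "b = \<xi> (-1) z $ 2 $ 1"
  define P Q where "P w = F w 1 $ 1 $ 1" and "Q w = F w 1 $ 2 $ 1" for w
  define G11 where "G11 w = cnj p * P w + cnj q * Q w" for w
  define G21 where "G21 w = p * Q w - q * P w" for w
  obtain \<delta> K r where \<delta>: "\<delta> > 0" "r \<noteq> 0" "ball z \<delta> \<subseteq> D'"
    and est: "\<And>h. cmod h < \<delta> \<Longrightarrow> \<exists>s. s \<noteq> 0 \<and> cmod s \<le> K \<and> cmod (1 / s) \<le> K \<and>
       cmod (G11 (z + h) - r * s) \<le> K * cmod h \<and> cmod (cnj (G11 (z + h)) - 1 / (r * s)) \<le> K * cmod h \<and>
       cmod (G21 (z + h) - (h * (b * s / r) - cnj (h * (a * r / s)))) \<le> K * (cmod h)\<^sup>2"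
    using frame_transition_estimate[OF D pot sol D' iwa]
    unfolding a_def b_def G11_def G21_def P_def Q_def p_def q_def by metis
  have unit: "P w * cnj (P w) + Q w * cnj (Q w) = 1" if "w \<in> D'" for w
  proof -
    have "F w 1 \<in> SU2" using iwa that by (simp add: iwasawa_decomposition_def Loop_SU2_def)
    from SU2_entries(3)[OF this] show ?thesis by (simp add: P_def Q_def)
  qed
  have pq: "p * cnj p + q * cnj q = 1" using unit[OF D'(3)] by (simp add: P_def Q_def p_def q_def)
  have G_unit: "(cmod (G11 w))\<^sup>2 + (cmod (G21 w))\<^sup>2 = 1" if "w \<in> D'" for w
  proof -
    have "G11 w * cnj (G11 w) + G21 w * cnj (G21 w)
       = (p * cnj p + q * cnj q) * (P w * cnj (P w) + Q w * cnj (Q w))"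
      by (simp add: G11_def G21_def algebra_simps)
    also have "\<dots> = 1" by (simp add: pq unit[OF that])
    finally have "of_real ((cmod (G11 w))\<^sup>2 + (cmod (G21 w))\<^sup>2) = (1 :: complex)"
      unfolding of_real_add complex_norm_square .
    then show ?thesis using of_real_eq_1_iff by blast
  qed
  define \<alpha> \<beta> where "\<alpha> = a * r\<^sup>2" and "\<beta> = b / r\<^sup>2"
  obtain s0 where "cmod s0 \<le> K" using est[of 0] \<delta> by auto
  then have K: "K \<ge> 0" by (meson norm_ge_zero order_trans)
  define N where "N = cmod b * K / cmod r + cmod a * cmod r * K + K"
  define M where "M = K * (1 + cmod \<beta> + cmod \<alpha>)"
  have N0: "N \<ge> 0" unfolding N_def using K by simp
  \<comment> \<open>Small enough that \<open>|G 2 1| \<le> N |h| \<le> 1/2\<close>, which keeps \<open>G 1 1\<close> away from \<open>0\<close>.\<close>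
  define d where "d = min \<delta> (min 1 (1 / (2 * N + 1)))"
  have d: "d > 0" "d \<le> \<delta>" "d \<le> 1" "d \<le> 1 / (2 * N + 1)" using \<delta> N0 by (auto simp: d_def min_le_iff_disj)
  have main: "cmod (G11 (z + h)) \<ge> 1 / 2 \<and>
      cmod (G21 (z + h) - G11 (z + h) * (\<beta> * h - cnj (\<alpha> * h))) \<le> M * (cmod h)\<^sup>2" if h: "cmod h < d" for h
  proof -
    have zh: "z + h \<in> D'" using h d \<delta> by (auto simp: dist_norm)
    have "cmod h < \<delta>" using h d by simp
    from est[OF this] obtain s where s: "s \<noteq> 0" "cmod s \<le> K" "cmod (1 / s) \<le> K"
      "cmod (G11 (z + h) - r * s) \<le> K * cmod h" "cmod (cnj (G11 (z + h)) - 1 / (r * s)) \<le> K * cmod h"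
      "cmod (G21 (z + h) - (h * (b * s / r) - cnj (h * (a * r / s)))) \<le> K * (cmod h)\<^sup>2" by blast
    define x where "x = h * (b * s / r)"
    define y where "y = h * (a * r / s)"
    have "cmod x = cmod h * (cmod b * cmod s / cmod r)" by (simp add: x_def norm_mult norm_divide)
    also have "\<dots> \<le> cmod h * (cmod b * K / cmod r)"
      using s(2) by (intro mult_left_mono divide_right_mono) auto
    finally have x: "cmod x \<le> cmod h * (cmod b * K / cmod r)" .
    have "cmod y = cmod h * (cmod a * cmod r * cmod (1 / s))" by (simp add: y_def norm_mult norm_divide)
    also have "\<dots> \<le> cmod h * (cmod a * cmod r * K)"
      using s(3) by (intro mult_left_mono) auto
    finally have y: "cmod y \<le> cmod h * (cmod a * cmod r * K)" .
    have "K * (cmod h)\<^sup>2 \<le> K * cmod h"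
      using K h d by (intro mult_left_mono) (auto simp: power2_eq_square mult_left_le)
    then have "cmod (G21 (z + h)) \<le> N * cmod h"
      using s(6) x y norm_triangle_ineq[of "G21 (z + h) - (x - cnj y)" "x - cnj y"] norm_triangle_ineq4[of x "cnj y"]
      unfolding x_def[symmetric] y_def[symmetric] by (simp add: N_def algebra_simps)
    also have "\<dots> \<le> N * (1 / (2 * N + 1))" using h d N0 by (intro mult_left_mono) auto
    also have "\<dots> \<le> 1 / 2" using N0 by (simp add: field_simps)
    finally have "(cmod (G21 (z + h)))\<^sup>2 \<le> (1 / 2)\<^sup>2" by (intro power_mono) auto
    with G_unit[OF zh] have "(cmod (G11 (z + h)))\<^sup>2 \<ge> (1 / 2)\<^sup>2" by (simp add: power2_eq_square)
    then have G11: "cmod (G11 (z + h)) \<ge> 1 / 2" by (rule power2_le_imp_le) simp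
    have x': "x = r * s * (\<beta> * h)" using \<delta>(2) by (simp add: x_def \<beta>_def power2_eq_square field_simps)
    have y': "y = 1 / (r * s) * (\<alpha> * h)" using \<delta>(2) s(1) by (simp add: y_def \<alpha>_def power2_eq_square field_simps)
    have "G21 (z + h) - G11 (z + h) * (\<beta> * h - cnj (\<alpha> * h))
      = (G21 (z + h) - (x - cnj y)) - (G11 (z + h) - r * s) * (\<beta> * h)
        - cnj (- ((cnj (G11 (z + h)) - 1 / (r * s)) * (\<alpha> * h)))"
      unfolding x' y' by (simp add: algebra_simps)
    also have "cmod \<dots> \<le> cmod (G21 (z + h) - (x - cnj y)) + cmod ((G11 (z + h) - r * s) * (\<beta> * h))
        + cmod (- ((cnj (G11 (z + h)) - 1 / (r * s)) * (\<alpha> * h)))"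
      by (rule norm_diff_cnj_le)
    also have "\<dots> \<le> K * (cmod h)\<^sup>2 + K * cmod h * (cmod \<beta> * cmod h) + K * cmod h * (cmod \<alpha> * cmod h)"
      unfolding norm_minus_cancel norm_mult using s(4-6) unfolding x_def[symmetric] y_def[symmetric]
      by (intro add_mono mult_right_mono) auto
    also have "\<dots> = M * (cmod h)\<^sup>2" by (simp add: M_def algebra_simps power2_eq_square)
    finally show ?thesis using G11 by simp
  qed
  define T where "T w = G21 w / G11 w" for w
  have T0: "T z = 0" by (simp add: T_def G21_def P_def Q_def p_def q_def)
  show ?thesis
  proof (rule that[of \<alpha> \<beta> T d])
    show "\<alpha> * \<beta> = \<xi> (-1) z $ 1 $ 2 * \<xi> (-1) z $ 2 $ 1"
      using \<delta>(2) by (simp add: \<alpha>_def \<beta>_def a_def b_def)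
    show "(T has_derivative (\<lambda>h. \<beta> * h - cnj (\<alpha> * h))) (at z)"
    proof (rule has_derivative_quadratic_error[where K="2 * M" and T=T and z=z and d=d
          and L="\<lambda>h. \<beta> * h - cnj (\<alpha> * h)", OF _ d(1) T0])
      show "bounded_linear (\<lambda>h. \<beta> * h - cnj (\<alpha> * h))"
        by (intro bounded_linear_sub bounded_linear_mult_right
              bounded_linear_compose[OF bounded_linear_cnj bounded_linear_mult_right])
      fix h assume "cmod h < d"
      from main[OF this] have G: "cmod (G11 (z + h)) \<ge> 1 / 2"
        and e: "cmod (G21 (z + h) - G11 (z + h) * (\<beta> * h - cnj (\<alpha> * h))) \<le> M * (cmod h)\<^sup>2" by auto
      have nz: "G11 (z + h) \<noteq> 0" using G by auto
      have "cmod (T (z + h) - (\<beta> * h - cnj (\<alpha> * h)))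
          = cmod (G21 (z + h) - G11 (z + h) * (\<beta> * h - cnj (\<alpha> * h))) / cmod (G11 (z + h))"
        unfolding norm_divide[symmetric] T_def using nz by (simp add: diff_divide_distrib)
      also have "\<dots> \<le> M * (cmod h)\<^sup>2 / (1 / 2)"
        using G e by (intro frac_le) (auto intro: order_trans[OF norm_ge_zero])
      finally show "cmod (T (z + h) - (\<beta> * h - cnj (\<alpha> * h))) \<le> 2 * M * (cmod h)\<^sup>2" by simp
    qed
    fix w assume "dist z w < d"
    then have "cmod (G11 (z + (w - z))) \<ge> 1 / 2"
      using main[of "w - z"] by (simp add: dist_norm norm_minus_commute)
    then have nz: "G11 w \<noteq> 0" by auto
    have "G11 w * (p - cnj q * T w) = (p * cnj p + q * cnj q) * P w"
      using nz by (simp add: T_def right_diff_distrib) (simp add: G11_def G21_def algebra_simps)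
    moreover have "G11 w * (q + cnj p * T w) = (p * cnj p + q * cnj q) * Q w"
      using nz by (simp add: T_def distrib_left) (simp add: G11_def G21_def algebra_simps)
    ultimately show "\<exists>g. g \<noteq> 0 \<and> F w 1 $ 1 $ 1 = g * (p - cnj q * T w) \<and> F w 1 $ 2 $ 1 = g * (q + cnj p * T w)"
      using nz pq by (intro exI[of _ "G11 w"]) (simp add: P_def Q_def)
  qed (fact T0 d(1))+
qed

section \<open>The Hopf differential of the Gauss map\<close>

lemma wirtinger_linear:
  assumes "(h has_derivative (\<lambda>v. A * v + B * cnj v)) (at z)"
  shows "wirtinger h z = A"
  using frechet_derivative_at[OF assms, symmetric] by (simp add: wirtinger_def algebra_simps)

text \<open>The matrix with first column \<open>(x, y)\<close> is in \<open>SU(2)\<close>, so \<open>\<phi>\<close> is a rotation of the sphere applied to \<open>T\<close>,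
  with derivative \<open>1 / y\<^sup>2\<close> at \<open>T = 0\<close>; the factor \<open>1 / |y|\<^sup>4\<close> in the product of the Wirtinger derivatives
  cancels against \<open>(1 + |x / y|\<^sup>2)\<^sup>2\<close>.\<close>

lemma moebius_hopf:
  assumes T: "(T has_derivative (\<lambda>h. \<beta> * h - cnj (\<alpha> * h))) (at z)" "T z = 0"
    and xy: "y \<noteq> 0" "x * cnj x + y * cnj y = 1"
    and \<phi>: "\<forall>\<^sub>F w in nhds z. \<phi> w = - (x - cnj y * T w) / (y + cnj x * T w)"
  shows "\<phi> differentiable (at z)"
    "wirtinger \<phi> z * wirtinger (\<lambda>w. cnj (\<phi> w)) z / (1 + (cmod (\<phi> z))\<^sup>2)\<^sup>2 = - (\<alpha> * \<beta>)"
proof -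
  define m where "m t = - (x - cnj y * t) / (y + cnj x * t)" for t
  have "(m has_field_derivative (cnj y * y + x * cnj x) / (y * y)) (at (T z))"
    unfolding m_def[abs_def] using xy(1) T(2) by (auto intro!: derivative_eq_intros)
  also have "cnj y * y + x * cnj x = 1" using xy(2) by (simp add: add.commute mult.commute)
  finally have "(m has_derivative (\<lambda>h. 1 / (y * y) * h)) (at (T z))"
    by (simp only: has_field_derivative_def)
  from has_derivative_compose[OF T(1) this]
  have m: "((\<lambda>w. m (T w)) has_derivative (\<lambda>h. 1 / (y * y) * (\<beta> * h - cnj (\<alpha> * h)))) (at z)" .
  have \<phi>m: "\<phi> z = m (T z)" using eventually_nhds_x_imp_x[OF \<phi>] by (simp add: m_def)
  have ev: "\<forall>\<^sub>F w in at z. m (T w) = \<phi> w"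
    using eventually_nhds_conv_at \<phi> by (auto simp: eventually_nhds_conv_at m_def elim!: eventually_mono)
  have der: "(\<phi> has_derivative (\<lambda>h. 1 / (y * y) * (\<beta> * h - cnj (\<alpha> * h)))) (at z)"
    by (rule has_derivative_transform_eventually[OF m ev \<phi>m[symmetric]]) simp
  then show "\<phi> differentiable (at z)" by (auto simp: differentiable_def)
  have 1: "wirtinger \<phi> z = \<beta> / (y * y)"
    by (rule wirtinger_linear[where B="- cnj \<alpha> / (y * y)"]) (use der in \<open>simp add: algebra_simps diff_divide_distrib\<close>)
  have "((\<lambda>w. cnj (\<phi> w)) has_derivative (\<lambda>h. cnj (1 / (y * y) * (\<beta> * h - cnj (\<alpha> * h))))) (at z)"
    by (rule has_derivative_cnj[OF der])
  then have 2: "wirtinger (\<lambda>w. cnj (\<phi> w)) z = - \<alpha> / (cnj y * cnj y)"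
    by (intro wirtinger_linear[where B="cnj \<beta> / (cnj y * cnj y)"]) (simp add: algebra_simps diff_divide_distrib)
  have "\<phi> z = - x / y" using \<phi>m T(2) by (simp add: m_def)
  then have "of_real (1 + (cmod (\<phi> z))\<^sup>2) = 1 + (x / y) * cnj (x / y)"
    by (simp only: of_real_add of_real_1 complex_norm_square) simp
  also have "\<dots> = (x * cnj x + y * cnj y) / (y * cnj y)" using xy(1) by (simp add: field_simps)
  finally have 3: "1 + (complex_of_real (cmod (\<phi> z)))\<^sup>2 = 1 / (y * cnj y)" using xy(2) by simp
  have "wirtinger \<phi> z * wirtinger (\<lambda>w. cnj (\<phi> w)) z / (1 + (cmod (\<phi> z))\<^sup>2)\<^sup>2
      = \<beta> / (y * y) * (- \<alpha> / (cnj y * cnj y)) / (1 / (y * cnj y))\<^sup>2"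
    unfolding 1 2 by (simp add: 3)
  also have "\<dots> = - (\<alpha> * \<beta>)" using xy(1) by (simp add: power2_eq_square field_simps)
  finally show "wirtinger \<phi> z * wirtinger (\<lambda>w. cnj (\<phi> w)) z / (1 + (cmod (\<phi> z))\<^sup>2)\<^sup>2 = - (\<alpha> * \<beta>)" .
qed

text \<open>If the Gauss map is finite at \<open>z\<close>, it is the rotation of \<open>T\<close> with the parameters \<open>p\<close>, \<open>q\<close>. If it is
  infinite, its inverse is the rotation of \<open>- T\<close> with \<open>p\<close> and \<open>q\<close> exchanged; this changes the sign of both
  \<open>\<alpha>\<close> and \<open>\<beta>\<close>.\<close>

lemma gauss_map_hopf:
  fixes F :: "complex \<Rightarrow> complex \<Rightarrow> complex^2^2"
  assumes T: "(T has_derivative (\<lambda>h. \<beta> * h - cnj (\<alpha> * h))) (at z)" "T z = 0"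
    and pq: "p = F z 1 $ 1 $ 1" "q = F z 1 $ 2 $ 1" "p * cnj p + q * cnj q = 1"
    and d: "d > 0" "\<And>w. dist z w < d \<Longrightarrow>
       \<exists>g. g \<noteq> 0 \<and> F w 1 $ 1 $ 1 = g * (p - cnj q * T w) \<and> F w 1 $ 2 $ 1 = g * (q + cnj p * T w)"
  shows "sphere_differentiable_at (gauss_map F) z" "abresch_rosenberg (gauss_map F) z = - (\<alpha> * \<beta>)"
proof -
  have near: "\<forall>\<^sub>F w in nhds z. dist z w < d"
    using d(1) by (auto simp: eventually_nhds_metric dist_commute)
  have contT: "isCont T z" using T(1) by (rule has_derivative_continuous)
  have "sphere_differentiable_at (gauss_map F) z \<and> abresch_rosenberg (gauss_map F) z = - (\<alpha> * \<beta>)"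
  proof (cases "q = 0")
    case False
    have "isCont (\<lambda>w. q + cnj p * T w) z" by (intro continuous_intros contT)
    then have "\<forall>\<^sub>F w in nhds z. q + cnj p * T w \<noteq> 0"
      using False T(2) by (auto simp: isCont_def eventually_nhds_conv_at dest: tendsto_imp_eventually_ne)
    with near have ev: "\<forall>\<^sub>F w in nhds z. gauss_map F w = Some (- (p - cnj q * T w) / (q + cnj p * T w))"
    proof eventually_elim
      case (elim w)
      from d(2)[OF elim(1)] obtain g where "g \<noteq> 0" "F w 1 $ 1 $ 1 = g * (p - cnj q * T w)"
        "F w 1 $ 2 $ 1 = g * (q + cnj p * T w)" by blast
      then show ?case using elim(2) by (simp add: gauss_map_def diff_divide_distrib)
    qed
    have fin: "gauss_map F z \<noteq> None" using False by (simp add: gauss_map_def pq)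
    have rep: "local_rep (gauss_map F) z = (\<lambda>w. affine (gauss_map F w))" using fin by (simp add: local_rep_def)
    have "\<forall>\<^sub>F w in nhds z. affine (gauss_map F w) = - (p - cnj q * T w) / (q + cnj p * T w)"
      using ev by (rule eventually_mono) (simp add: affine_def)
    from moebius_hopf[OF T False pq(3) this] show ?thesis
      using ev fin by (auto simp: sphere_differentiable_at_def abresch_rosenberg_def rep elim: eventually_mono)
  next
    case True
    then have p0: "p \<noteq> 0" using pq(3) by auto
    have "isCont (\<lambda>w. p - cnj q * T w) z" by (intro continuous_intros contT)
    then have "\<forall>\<^sub>F w in nhds z. p - cnj q * T w \<noteq> 0"
      using p0 T(2) by (auto simp: isCont_def eventually_nhds_conv_at dest: tendsto_imp_eventually_ne)
    with near have ev: "\<forall>\<^sub>F w in nhds z.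
        sphere_inv (gauss_map F w) = Some (- (q - cnj p * (- T w)) / (p + cnj q * (- T w)))"
    proof eventually_elim
      case (elim w)
      from d(2)[OF elim(1)] obtain g where "g \<noteq> 0" "F w 1 $ 1 $ 1 = g * (p - cnj q * T w)"
        "F w 1 $ 2 $ 1 = g * (q + cnj p * T w)" by blast
      moreover define A E where "A = p - cnj q * T w" and "E = q + cnj p * T w"
      ultimately have F: "g \<noteq> 0" "F w 1 $ 1 $ 1 = g * A" "F w 1 $ 2 $ 1 = g * E" "A \<noteq> 0"
        using elim(2) by simp_all
      have "q - cnj p * (- T w) = E" "p + cnj q * (- T w) = A" by (simp_all add: A_def E_def)
      then show ?case using F by (simp only:) (simp add: gauss_map_def sphere_inv_def)
    qed
    have inf: "gauss_map F z = None" using True by (simp add: gauss_map_def pq)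
    have rep: "local_rep (gauss_map F) z = (\<lambda>w. affine (sphere_inv (gauss_map F w)))" using inf by (simp add: local_rep_def)
    have T': "((\<lambda>w. - T w) has_derivative (\<lambda>h. (- \<beta>) * h - cnj ((- \<alpha>) * h))) (at z)"
      using has_derivative_minus[OF T(1)] by (simp add: algebra_simps)
    have "\<forall>\<^sub>F w in nhds z. affine (sphere_inv (gauss_map F w)) = - (q - cnj p * (- T w)) / (p + cnj q * (- T w))"
      using ev by (rule eventually_mono) (simp add: affine_def)
    from moebius_hopf[OF T' _ p0 _ this] show ?thesis
      using ev inf T(2) pq(3) by (auto simp: sphere_differentiable_at_def abresch_rosenberg_def rep add.commute elim: eventually_mono)
  qed
  then show "sphere_differentiable_at (gauss_map F) z" "abresch_rosenberg (gauss_map F) z = - (\<alpha> * \<beta>)" by auto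
qed

section \<open>Singular points and the initial frame\<close>

text \<open>For \<open>|u| = 1\<close> one has \<open>1 - u\<^sup>2 = u (cnj u - u)\<close> and \<open>1 + u\<^sup>2 = u (cnj u + u)\<close>, so \<open>f\<^sub>z\<close> is a complex multiple
  of a real vector and the two partial derivatives of \<open>f\<close> are linearly dependent.\<close>

lemma singular_point_if_unimodular:
  fixes f :: "complex \<Rightarrow> real^3"
  assumes surf: "maximal_surface_of D g f" and z: "z \<in> D" and g: "g z = Some u" and u: "cmod u = 1"
  shows "singular_point f z"
  unfolding singular_point_def immersion_at_def
proof
  assume "\<exists>f'. (f has_derivative f') (at z) \<and> inj f'"
  then obtain f' where f': "(f has_derivative f') (at z)" "inj f'" by blast
  interpret f': linear f' by (rule has_derivative_linear[OF f'(1)])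
  define h where "h = local_rep g z"
  have hz: "h z = u" using g by (simp add: h_def local_rep_def affine_def)
  define \<omega> where "\<omega> = - 2 * \<i> * wirtinger (\<lambda>w. cnj (h w)) z / ((cmod (h z))\<^sup>2 + 1)\<^sup>2"
  define \<mu> where "\<mu> = 2 * (2 * \<omega> * u)"
  define v :: "real^3" where "v = (- Im u) *\<^sub>R e1 (f z) + Re u *\<^sub>R e2 (f z) + e3 (f z)"
  have uu: "u * cnj u = 1" using u by (simp add: complex_norm_square[symmetric])
  have "1 - u\<^sup>2 = u * (cnj u - u)" "1 + u\<^sup>2 = u * (cnj u + u)"
    using uu by (simp_all add: algebra_simps power2_eq_square)
  moreover have "cnj u - u = - (2 * \<i> * Im u)" "cnj u + u = 2 * Re u" by (simp_all add: complex_eq_iff)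
  ultimately have uu2: "1 - u\<^sup>2 = - (2 * \<i> * u * Im u)" "1 + u\<^sup>2 = 2 * u * Re u" by (simp_all add: mult_ac)
  have form: "surface_form g z = vector [2 * \<omega> * u * (- Im u), 2 * \<omega> * u * Re u, 2 * \<omega> * u]"
  proof -
    have "surface_form g z = vector [- \<i> * \<omega> * (1 - (h z)\<^sup>2), \<omega> * (1 + (h z)\<^sup>2), 2 * h z * \<omega>]"
      unfolding surface_form_def \<omega>_def h_def Let_def using g by simp
    then show ?thesis unfolding hz uu2 by (simp add: mult_ac)
  qed
  have comp: "of_real (f' 1 $ k) - \<i> * of_real (f' \<i> $ k) = \<mu> * of_real (v $ k)" for k
  proof -
    have "((\<lambda>w. complex_of_real (f w $ k)) has_derivative (\<lambda>h. of_real (f' h $ k))) (at z)"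
      by (intro has_derivative_of_real bounded_linear.has_derivative[OF bounded_linear_vec_nth f'(1)])
    then have "wirtinger (\<lambda>w. complex_of_real (f w $ k)) z = (of_real (f' 1 $ k) - \<i> * of_real (f' \<i> $ k)) / 2"
      using frechet_derivative_at by (metis (no_types, lifting) wirtinger_def)
    moreover have "wirtinger (\<lambda>w. complex_of_real (f w $ k)) z =
        surface_form g z $ 1 * complex_of_real (e1 (f z) $ k) +
        surface_form g z $ 2 * complex_of_real (e2 (f z) $ k) +
        surface_form g z $ 3 * complex_of_real (e3 (f z) $ k)"
      using surf z unfolding maximal_surface_of_def by blast
    ultimately show ?thesis by (simp add: form v_def \<mu>_def algebra_simps)
  qed
  have f1: "f' 1 $ k = Re \<mu> * v $ k" and fi: "f' \<i> $ k = - (Im \<mu> * v $ k)" for k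
    using arg_cong[OF comp[of k], of Re] arg_cong[OF comp[of k], of Im] by simp_all
  \<comment> \<open>A direction in which the derivative vanishes; if \<open>\<mu> = 0\<close>, any direction does.\<close>
  define \<zeta> where "\<zeta> = (if \<mu> = 0 then 1 else Complex (Im \<mu>) (Re \<mu>))"
  have "\<zeta> = Re \<zeta> *\<^sub>R 1 + Im \<zeta> *\<^sub>R \<i>" by (simp add: complex_eq_iff)
  then have "f' \<zeta> = Re \<zeta> *\<^sub>R f' 1 + Im \<zeta> *\<^sub>R f' \<i>" by (metis f'.add f'.scaleR)
  also have "\<dots> = 0" by (auto simp: vec_eq_iff f1 fi \<zeta>_def)
  finally have "f' \<zeta> = f' 0" by (simp add: f'.zero)
  then have "\<zeta> = 0" by (rule injD[OF f'(2)])
  then show False by (auto simp: \<zeta>_def complex_eq_iff split: if_splits)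
qed

text \<open>When \<open>C z\<close> is unitary on the circle, so is \<open>Bp z\<close>. By rigidity its lower left entry is then constant,
  and being odd it vanishes; so \<open>Bp z\<close> multiplies the first column of \<open>F z\<close> by a scalar.\<close>

lemma gauss_map_unimodular:
  fixes C F Bp :: "complex \<Rightarrow> complex \<Rightarrow> complex^2^2"
  assumes F: "F z \<in> Loop_SU2" and Bp: "Bp z \<in> Loop_SL2_plus"
    and iwa: "\<And>l. cmod l = 1 \<Longrightarrow> C z l = F z l ** Bp z l"
    and SU2: "\<And>l. cmod l = 1 \<Longrightarrow> C z l $ 2 $ 2 = cnj (C z l $ 1 $ 1)"
      "\<And>l. cmod l = 1 \<Longrightarrow> C z l $ 1 $ 2 = - cnj (C z l $ 2 $ 1)"
    and eq: "cmod (C z 1 $ 1 $ 1) = cmod (C z 1 $ 2 $ 1)" "C z 1 $ 2 $ 1 \<noteq> 0"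
  shows "\<exists>u. gauss_map F z = Some u \<and> cmod u = 1"
proof -
  obtain H where H: "\<And>j k. disc_algebra (H j k)" "\<And>j k l. cmod l = 1 \<Longrightarrow> H j k l = Bp z l $ j $ k"
    "\<And>l. cmod l \<le> 1 \<Longrightarrow> H 1 1 l * H 2 2 l - H 1 2 l * H 2 1 l = 1" "H 1 2 0 = 0" "H 2 1 0 = 0"
    by (rule Loop_SL2_plus_extension[OF Bp]) blast
  have FS: "F z l \<in> SU2" if "cmod l = 1" for l using F that by (auto simp: Loop_SU2_def)
  have rel: "H 2 1 l = cnj (- H 1 2 l)" if l: "cmod l = 1" for l
  proof -
    have "Bp z l = (\<chi> j k. cnj (F z l $ k $ j)) ** C z l"
      unfolding iwa[OF l] matrix_mul_assoc SU2_mult_adjoint[OF FS[OF l]] by simp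
    then show ?thesis unfolding H(2)[OF l] using SU2[OF l] SU2_entries(1,2)[OF FS[OF l]]
      by (simp add: matrix_matrix_mult_def sum_2 algebra_simps)
  qed
  have "H 2 1 1 = H 2 1 0"
    by (rule disc_algebra_rigid[OF H(1) disc_algebra_minus[OF H(1)] rel]) auto
  then have B21: "Bp z 1 $ 2 $ 1 = 0" using H(2)[of 1 2 1] H(5) by simp
  have "C z 1 $ j $ 1 = F z 1 $ j $ 1 * Bp z 1 $ 1 $ 1" for j
    using iwa[of 1] B21 by (simp add: matrix_matrix_mult_def sum_2)
  with eq have "cmod (F z 1 $ 1 $ 1) = cmod (F z 1 $ 2 $ 1)" "F z 1 $ 2 $ 1 \<noteq> 0"
    by (auto simp: norm_mult)
  then show ?thesis by (simp add: gauss_map_def norm_divide)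
qed

theorem theorem4p6:
  fixes D D' :: "complex set"
    and \<xi> :: "int \<Rightarrow> complex \<Rightarrow> complex^2^2"
    and a b B :: "complex \<Rightarrow> complex"
    and C F Bp :: "complex \<Rightarrow> complex \<Rightarrow> complex^2^2"
    and c :: real
    and f :: "complex \<Rightarrow> real^3"
  assumes "open D" and "simply_connected D" and "0 \<in> D"
    and "holomorphic_potential D \<xi>"
    and "\<And>z. z \<in> D \<Longrightarrow> \<xi> (-1) z = vector [vector [0, a z], vector [b z, 0]]"
    and "a 0 \<noteq> 0"
    and "\<And>z. z \<in> D \<Longrightarrow> B z = - b z * a z"
    and "solves_potential D \<xi> C"
    and "\<And>l. l \<in> sphere 0 1 \<Longrightarrow> C 0 l =
          vector [vector [1 / sqrt 2 * exp (\<i> * c), 1 / sqrt 2 * (\<i> * exp (\<i> * c) * l)],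
                  vector [1 / sqrt 2 * (\<i> * exp (- (\<i> * c)) * inverse l), 1 / sqrt 2 * exp (- (\<i> * c))]]"
    and "D' \<subseteq> D" and "open D'" and "simply_connected D'" and "0 \<in> D'"
    and "\<And>z. z \<in> D' \<Longrightarrow> a z \<noteq> 0"
    and "iwasawa_decomposition D' C F Bp"
    and "maximal_surface_of D' (gauss_map F) f"
  shows "singular_point f 0 \<and> is_abresch_rosenberg D' (gauss_map F) B"
proof
  have "\<exists>u. gauss_map F 0 = Some u \<and> cmod u = 1"
  proof (rule gauss_map_unimodular)
    show "F 0 \<in> Loop_SU2" "Bp 0 \<in> Loop_SL2_plus" "\<And>l. cmod l = 1 \<Longrightarrow> C 0 l = F 0 l ** Bp 0 l"
      using assms(13,15) by (auto simp: iwasawa_decomposition_def)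
    fix l :: complex assume l: "cmod l = 1"
    have C0: "C 0 l = vector [vector [1 / sqrt 2 * exp (\<i> * c), 1 / sqrt 2 * (\<i> * exp (\<i> * c) * l)],
                  vector [1 / sqrt 2 * (\<i> * exp (- (\<i> * c)) * inverse l), 1 / sqrt 2 * exp (- (\<i> * c))]]"
      using assms(9)[of l] l by simp
    have "l * cnj l = 1" using l by (simp add: complex_norm_square[symmetric])
    then have "cnj (inverse l) = l"
      by (metis complex_cnj_cnj complex_cnj_inverse inverse_unique mult.commute)
    then show "C 0 l $ 2 $ 2 = cnj (C 0 l $ 1 $ 1)" "C 0 l $ 1 $ 2 = - cnj (C 0 l $ 2 $ 1)"
      unfolding C0 by (simp_all add: exp_cnj)
  next
    have C0: "C 0 1 = vector [vector [1 / sqrt 2 * exp (\<i> * c), 1 / sqrt 2 * (\<i> * exp (\<i> * c) * 1)],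
                  vector [1 / sqrt 2 * (\<i> * exp (- (\<i> * c)) * inverse 1), 1 / sqrt 2 * exp (- (\<i> * c))]]"
      using assms(9)[of 1] by simp
    show "cmod (C 0 1 $ 1 $ 1) = cmod (C 0 1 $ 2 $ 1)" "C 0 1 $ 2 $ 1 \<noteq> 0"
      unfolding C0 by (simp_all add: norm_mult norm_divide)
  qed
  then show "singular_point f 0"
    using singular_point_if_unimodular[OF assms(16,13)] by blast
  show "is_abresch_rosenberg D' (gauss_map F) B"
    unfolding is_abresch_rosenberg_def
  proof (intro ballI)
    fix z assume z: "z \<in> D'"
    define p q where "p = F z 1 $ 1 $ 1" and "q = F z 1 $ 2 $ 1"
    obtain T \<alpha> \<beta> d where T: "\<alpha> * \<beta> = \<xi> (-1) z $ 1 $ 2 * \<xi> (-1) z $ 2 $ 1" "T z = 0"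
      "(T has_derivative (\<lambda>h. \<beta> * h - cnj (\<alpha> * h))) (at z)" "d > 0"
      "\<And>w. dist z w < d \<Longrightarrow> \<exists>g. g \<noteq> 0 \<and> F w 1 $ 1 $ 1 = g * (p - cnj q * T w) \<and> F w 1 $ 2 $ 1 = g * (q + cnj p * T w)"
      unfolding p_def q_def
      by (rule frame_motion[OF assms(1,4,8,11,10) z assms(15)]) blast
    have "F z 1 \<in> SU2" using assms(15) z by (simp add: iwasawa_decomposition_def Loop_SU2_def)
    from SU2_entries(3)[OF this] have pq: "p * cnj p + q * cnj q = 1" by (simp add: p_def q_def)
    note * = gauss_map_hopf[where F=F and z=z and p=p and q=q and T=T and d=d, OF T(3,2) p_def q_def pq T(4,5)]
    have "B z = - (\<alpha> * \<beta>)"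
      using assms(5,7,10) z by (auto simp: T(1))
    then show "sphere_differentiable_at (gauss_map F) z \<and> B z = abresch_rosenberg (gauss_map F) z"
      using * by simp
  qed
qed

end
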